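(* Let $a>4$. There is $\epsilon_0>0$ such that for every $\epsilon$ with $0\le\epsilon<\epsilon_0$ the following holds. For $n\in\mathbb{Z}$ let $a(n)=a+\epsilon(1+\cos n)$ and let $L_n:\mathbb{R}^2\to\mathbb{R}^2$, $L_n(x,y)=(1+y-a(n)|x|,\,-x)$, be the nonautonomous Lozi map. Let $R=\frac{a}{4(a-2)}$ and $S=[-R,R]\times[-R,R]$, and for each $n\in\mathbb{Z}$ put $$H^{n+1}_1=\{(x,y)\in L_n(S)\cap S: y>0\},\quad H^{n+1}_2=\{(x,y)\in L_n(S)\cap S: y<0\},$$ $$V^{n}_1=\{(x,y)\in L_n^{-1}(S)\cap S: x<0\},\quad V^{n}_2=\{(x,y)\in L_n^{-1}(S)\cap S: x>0\}.$$ Then there are constants $\mu_h,\mu_v\ge0$ and $\mu$ with $0<\mu<1-\mu_h\mu_v$, independent of $n$, such that for every $n$ the sets $V^n_i$ are $\mu_v$-vertical strips and the sets $H^{n+1}_i$ are $\mu_h$-horizontal strips ($i=1,2$), and Assumptions 1 and 3 of the nonautonomous Conley-Moser conditions (stated in the context) hold for the sequence $\{L_n,S\}_{n\in\mathbb{Z}}$ with these strips and constants. Consequently $\{L_n\}$ possesses a chaotic saddle inside $S$: there are sets $\Lambda_n\subset S$, $n\in\mathbb{Z}$, with $L_n(\Lambda_n)=\Lambda_{n+1}$, and homeomorphisms $\phi_n:\Lambda_n\to\Sigma_{\{A^n\}}$ with $\phi_{n+1}\circ L_n=\sigma\circ\phi_n$ on $\Lambda_n$ for all $n$; in other words, $\{\Lambda_n,L_n\}_{n=-\infty}^{+\infty}$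 is an infinite sequence of chaotic invariant sets for which $\Lambda=\bigcup_{n\in\mathbb{Z}}\Lambda_n$ contains an uncountable infinity of orbits, each of them unstable (of saddle type), and the dynamics on the invariant set exhibits sensitive dependence on initial conditions.
   Context: The inverse of $L_n$ is $L_n^{-1}(x,y)=(-y,\,x+a(n)|y|-1)$. Indices $i,j$ range over $I=\{1,2\}$. **Curves and strips.** For closed intervals $I_x,I_y\subset[-R,R]$: a $\mu_h$-horizontal curve is the graph, contained in $S$, of a function $h:I_x\to\mathbb{R}$ with $|h(x_1)-h(x_2)|\le\mu_h|x_1-x_2|$; a $\mu_v$-vertical curve is the graph $\{(v(y),y)\}$, contained in $S$, of a function $v:I_y\to\mathbb{R}$ with $|v(y_1)-v(y_2)|\le\mu_v|y_1-y_2|$. Given two $\mu_v$-vertical curves $v_1<v_2$ on $I_y$, the corresponding $\mu_v$-vertical strip is $V=\{(x,y):x\in[v_1(y),v_2(y)],\,y\in I_y\}$; its horizontal boundary is $\partial_hV=\{(x,y)\in V:y\in\partial I_y\}$ and its vertical boundary is $\partial_vV=\partial V\setminus\partial_hV$. Given two $\mu_h$-horizontal curves $h_1<h_2$ on $I_x$, the corresponding $\mu_h$-horizontal strip is $H=\{(x,y):y\in[h_1(x),h_2(x)],\,x\in I_x\}$; its vertical boundary is $\partial_vH=\{(x,y)\in H:x\in\partial I_x\}$ and its horizontal boundary is $\partial_hH=\partial H\setminus\partial_vH$. For $V^n_i$ and $H^{n+1}_i$ the intervals $I_y$ and $I_x$ are $[-R,R]$. A *$\mu_h$-horizontal strip contained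 in a $\mu_v$-vertical strip* $V$ is a closed region $\tilde H\subset V$ bounded by two disjoint $\mu_h$-horizontal curves contained in $V$ (whose domain intervals may differ), the remaining boundary components of $\tilde H$ being contained in $\partial_vV$. For such $\tilde H$, $\partial_v\tilde H=\partial\tilde H\cap\partial_vV$ and $\partial_h\tilde H=\partial\tilde H\setminus\partial_v\tilde H$. **Transition data.** Put $H^{n+1}_{ij}=H^{n+1}_i\cap V^{n+1}_j$ and $V^n_{ji}=L_n^{-1}(V^{n+1}_j)\cap V^n_i$. Let $A^n$ be the $2\times2$ matrix with $A^n_{ij}=1$ if $H^{n+1}_{ij}\neq\emptyset$ and $A^n_{ij}=0$ otherwise. Let $$\mathcal V^n=\bigcup_{i,j}V^n_i\cap L_n^{-1}(V^{n+1}_j),\qquad \mathcal H^{n+1}=\bigcup_{i,j}V^{n+1}_j\cap L_n(V^n_i),$$ so $L_n(\mathcal V^n)=\mathcal H^{n+1}$. For $\mathcal K=\mathcal V^n$ or $\mathcal H^{n+1}$, the cones of tangent vectors at points $z\in\mathcal K$ are $$S^s_{\mathcal K}=\{(\xi_z,\eta_z)\in\mathbb{R}^2:|\xi_z|\le\mu_v|\eta_z|,\ z\in\mathcal K\},\qquad S^u_{\mathcal K}=\{(\xi_z,\eta_z)\in\mathbb{R}^2:|\eta_z|\le\mu_h|\xi_z|,\ z\in\mathcal K\}.$$ **Nonautonomous Conley-Moser conditions** (for all $n\in\mathbb{Z}$): *Assumption 1.* $0\le\mu_v\mu_h<1$, $L_n(V^n_i)=H^{n+1}_i$, and for all $i,j\in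 I$ with $A^n_{ij}=1$: $H^{n+1}_{ij}$ is a $\mu_h$-horizontal strip contained in $V^{n+1}_j$, and $L_n$ maps $V^n_{ji}$ homeomorphically onto $H^{n+1}_{ij}$ with $L_n^{-1}(\partial_hH^{n+1}_{ij})\subset\partial_hV^n_i$. *Assumption 3 (cone condition).* $DL_n(S^u_{\mathcal V^n})\subset S^u_{\mathcal H^{n+1}}$ and $DL_n^{-1}(S^s_{\mathcal H^{n+1}})\subset S^s_{\mathcal V^n}$. Moreover, for $z\in\mathcal V^n$, if $(\xi_{L_n(z)},\eta_{L_n(z)})=DL_n(z)(\xi_z,\eta_z)\in S^u_{\mathcal H^{n+1}}$ then $|\xi_{L_n(z)}|\ge\frac1\mu|\xi_z|$; and for $z\in\mathcal H^{n+1}$, if $(\xi_{L_n^{-1}(z)},\eta_{L_n^{-1}(z)})=DL_n^{-1}(z)(\xi_z,\eta_z)\in S^s_{\mathcal V^n}$ then $|\eta_{L_n^{-1}(z)}|\ge\frac1\mu|\eta_z|$. (In particular $L_n$ is differentiable at points of $\mathcal V^n$ and $L_n^{-1}$ at points of $\mathcal H^{n+1}$.) **Symbolic dynamics.** $\Sigma_{\{A^n\}}$ is the space, with the product topology, of bi-infinite sequences over $\{1,2\}$. At time $n$ a sequence is written $s=(\cdots s_{n-2}s_{n-1}.s_ns_{n+1}\cdots)$, with adjacent symbols satisfying $A^k_{s_ks_{k+1}}=1$ for all $k\in\mathbb{Z}$. The shift $\sigma$ moves the point one place to the right: $\sigma(\cdots s_{n-1}.s_ns_{n+1}\cdots)=(\cdots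 s_{n-1}s_n.s_{n+1}\cdots)$. Equivalently, with $\tilde\sigma(s,n)=(\sigma(s),n+1)$, $f(x,y;n)=(L_n(x,y),n+1)$ and $\phi(x,y;n)=(\phi_n(x,y),n)$, one has $\phi\circ f=\tilde\sigma\circ\phi$. **Dynamical terms.** An orbit in $\Lambda$ is a sequence $(z_n)_{n\in\mathbb{Z}}$ with $z_n\in\Lambda_n$ and $z_{n+1}=L_n(z_n)$. It is of saddle type if along it there is a $DL_n$-invariant splitting $\mathbb{R}^2=E^s_n\oplus E^u_n$ into one-dimensional subspaces, with vectors in $E^s_n$ uniformly exponentially contracted in forward time and vectors in $E^u_n$ uniformly exponentially contracted in backward time. Sensitive dependence on initial conditions: there is $\delta>0$ such that for every $n$, every $z\in\Lambda_n$ and every neighbourhood $U$ of $z$ there are $z'\in U\cap\Lambda_n$ and $k\ge1$ with $|L_{n+k-1}\circ\cdots\circ L_n(z)-L_{n+k-1}\circ\cdots\circ L_n(z')|\ge\delta$. *)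

theory Defs
  imports "HOL-Analysis.Analysis"
begin

definition lozi :: "real \<Rightarrow> real \<times> real \<Rightarrow> real \<times> real" where
  "lozi b = (\<lambda>(x, y). (1 + y - b * \<bar>x\<bar>, - x))"

definition lozi_seq :: "real \<Rightarrow> real \<Rightarrow> int \<Rightarrow> real \<times> real \<Rightarrow> real \<times> real" where
  "lozi_seq a \<epsilon> n = lozi (a + \<epsilon> * (1 + cos (real_of_int n)))"

lemma bij_lozi: "bij (lozi b)"
  by (rule o_bij[where g = "\<lambda>(x, y). (- y, x + b * \<bar>y\<bar> - 1)"]) (auto simp: lozi_def fun_eq_iff)

lemma inv_lozi: "inv (lozi b) = (\<lambda>(x, y). (- y, x + b * \<bar>y\<bar> - 1))"
  by (rule inv_equality) (auto simp: lozi_def)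

definition square :: "real \<Rightarrow> (real \<times> real) set" where
  "square R = {-R..R} \<times> {-R..R}"

text \<open>The set \<open>horiz_set L S m i\<close> is $H^m_i$, built from the image of $S$ under $L_{m-1}$.\<close>

definition horiz_set ::
  "(int \<Rightarrow> real \<times> real \<Rightarrow> real \<times> real) \<Rightarrow> (real \<times> real) set \<Rightarrow> int \<Rightarrow> nat \<Rightarrow> (real \<times> real) set" where
  "horiz_set L S m i =
     {(x, y). (x, y) \<in> L (m - 1) ` S \<inter> S \<and> (i = 1 \<and> y > 0 \<or> i = 2 \<and> y < 0)}"

definition vert_set ::
  "(int \<Rightarrow> real \<times> real \<Rightarrow> real \<times> real) \<Rightarrow> (real \<times> real) set \<Rightarrow> int \<Rightarrow> nat \<Rightarrow> (real \<times> real) set" where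
  "vert_set L S n i =
     {(x, y). (x, y) \<in> L n -` S \<inter> S \<and> (i = 1 \<and> x < 0 \<or> i = 2 \<and> x > 0)}"

definition closed_interval :: "real set \<Rightarrow> bool" where
  "closed_interval I \<longleftrightarrow> (\<exists>c d. c < d \<and> I = {c..d})"

definition hgraph :: "(real \<Rightarrow> real) \<Rightarrow> real set \<Rightarrow> (real \<times> real) set" where
  "hgraph h I = {(x, h x) | x. x \<in> I}"

definition vgraph :: "(real \<Rightarrow> real) \<Rightarrow> real set \<Rightarrow> (real \<times> real) set" where
  "vgraph v I = {(v y, y) | y. y \<in> I}"

definition horizontal_curve :: "real \<Rightarrow> real \<Rightarrow> real set \<Rightarrow> (real \<Rightarrow> real) \<Rightarrow> bool" where
  "horizontal_curve R \<mu> I h \<longleftrightarrow>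
     closed_interval I \<and> hgraph h I \<subseteq> square R \<and> \<mu>-lipschitz_on I h"

definition vertical_curve :: "real \<Rightarrow> real \<Rightarrow> real set \<Rightarrow> (real \<Rightarrow> real) \<Rightarrow> bool" where
  "vertical_curve R \<mu> I v \<longleftrightarrow>
     closed_interval I \<and> vgraph v I \<subseteq> square R \<and> \<mu>-lipschitz_on I v"

definition horizontal_strip :: "real \<Rightarrow> real \<Rightarrow> real set \<Rightarrow> (real \<times> real) set \<Rightarrow> bool" where
  "horizontal_strip R \<mu> I H \<longleftrightarrow>
     (\<exists>h1 h2. horizontal_curve R \<mu> I h1 \<and> horizontal_curve R \<mu> I h2 \<and> (\<forall>x\<in>I. h1 x < h2 x) \<and>
        H = {(x, y). x \<in> I \<and> y \<in> {h1 x..h2 x}})"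

definition vertical_strip :: "real \<Rightarrow> real \<Rightarrow> real set \<Rightarrow> (real \<times> real) set \<Rightarrow> bool" where
  "vertical_strip R \<mu> I V \<longleftrightarrow>
     (\<exists>v1 v2. vertical_curve R \<mu> I v1 \<and> vertical_curve R \<mu> I v2 \<and> (\<forall>y\<in>I. v1 y < v2 y) \<and>
        V = {(x, y). y \<in> I \<and> x \<in> {v1 y..v2 y}})"

text \<open>The corners of a vertical strip \<open>V\<close> over \<open>I\<close> belong to its horizontal boundary, whereas the
  corners of a horizontal strip \<open>K\<close> contained in \<open>V\<close> belong to its vertical boundary.\<close>

definition hbd_vstrip :: "real set \<Rightarrow> (real \<times> real) set \<Rightarrow> (real \<times> real) set" where
  "hbd_vstrip I V = {(x, y). (x, y) \<in> V \<and> y \<in> frontier I}"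

definition vbd_vstrip :: "real set \<Rightarrow> (real \<times> real) set \<Rightarrow> (real \<times> real) set" where
  "vbd_vstrip I V = frontier V - hbd_vstrip I V"

definition closed_region :: "(real \<times> real) set \<Rightarrow> bool" where
  "closed_region K \<longleftrightarrow> interior K \<noteq> {} \<and> connected (interior K) \<and> K = closure (interior K)"

definition horizontal_strip_in ::
  "real \<Rightarrow> real \<Rightarrow> real set \<Rightarrow> (real \<times> real) set \<Rightarrow> (real \<times> real) set \<Rightarrow> bool" where
  "horizontal_strip_in R \<mu> I V K \<longleftrightarrow>
     closed_region K \<and> K \<subseteq> V \<and>
     (\<exists>h1 I1 h2 I2.
        horizontal_curve R \<mu> I1 h1 \<and> horizontal_curve R \<mu> I2 h2 \<and>
        hgraph h1 I1 \<subseteq> V \<and> hgraph h2 I2 \<subseteq> V \<and> hgraph h1 I1 \<inter> hgraph h2 I2 = {} \<and>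
        hgraph h1 I1 \<union> hgraph h2 I2 \<subseteq> frontier K \<and>
        frontier K - (hgraph h1 I1 \<union> hgraph h2 I2) \<subseteq> vbd_vstrip I V)"

definition vbd_in :: "real set \<Rightarrow> (real \<times> real) set \<Rightarrow> (real \<times> real) set \<Rightarrow> (real \<times> real) set" where
  "vbd_in I V K = frontier K \<inter> vbd_vstrip I V"

definition hbd_in :: "real set \<Rightarrow> (real \<times> real) set \<Rightarrow> (real \<times> real) set \<Rightarrow> (real \<times> real) set" where
  "hbd_in I V K = frontier K - vbd_in I V K"

text \<open>The set \<open>Htrans H V n i j\<close> is $H^{n+1}_{ij}$ and \<open>Vtrans L V n j i\<close> is $V^n_{ji}$;
  \<open>Hcal L V m\<close> is $\mathcal{H}^m$, built from $L_{m-1}$.\<close>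

definition Htrans ::
  "(int \<Rightarrow> nat \<Rightarrow> (real \<times> real) set) \<Rightarrow> (int \<Rightarrow> nat \<Rightarrow> (real \<times> real) set) \<Rightarrow>
   int \<Rightarrow> nat \<Rightarrow> nat \<Rightarrow> (real \<times> real) set" where
  "Htrans H V n i j = H (n + 1) i \<inter> V (n + 1) j"

definition Vtrans ::
  "(int \<Rightarrow> real \<times> real \<Rightarrow> real \<times> real) \<Rightarrow> (int \<Rightarrow> nat \<Rightarrow> (real \<times> real) set) \<Rightarrow>
   int \<Rightarrow> nat \<Rightarrow> nat \<Rightarrow> (real \<times> real) set" where
  "Vtrans L V n j i = L n -` V (n + 1) j \<inter> V n i"

definition transition ::
  "(int \<Rightarrow> nat \<Rightarrow> (real \<times> real) set) \<Rightarrow> (int \<Rightarrow> nat \<Rightarrow> (real \<times> real) set) \<Rightarrow>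
   int \<Rightarrow> nat \<Rightarrow> nat \<Rightarrow> nat" where
  "transition H V n i j = (if Htrans H V n i j \<noteq> {} then 1 else 0)"

definition Vcal ::
  "(int \<Rightarrow> real \<times> real \<Rightarrow> real \<times> real) \<Rightarrow> (int \<Rightarrow> nat \<Rightarrow> (real \<times> real) set) \<Rightarrow>
   int \<Rightarrow> (real \<times> real) set" where
  "Vcal L V n = (\<Union>i\<in>{1, 2}. \<Union>j\<in>{1, 2}. V n i \<inter> L n -` V (n + 1) j)"

definition Hcal ::
  "(int \<Rightarrow> real \<times> real \<Rightarrow> real \<times> real) \<Rightarrow> (int \<Rightarrow> nat \<Rightarrow> (real \<times> real) set) \<Rightarrow>
   int \<Rightarrow> (real \<times> real) set" where
  "Hcal L V m = (\<Union>i\<in>{1, 2}. \<Union>j\<in>{1, 2}. V m j \<inter> L (m - 1) ` V (m - 1) i)"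

definition conley_moser_1 ::
  "(int \<Rightarrow> real \<times> real \<Rightarrow> real \<times> real) \<Rightarrow> real \<Rightarrow>
   (int \<Rightarrow> nat \<Rightarrow> (real \<times> real) set) \<Rightarrow> (int \<Rightarrow> nat \<Rightarrow> (real \<times> real) set) \<Rightarrow>
   real \<Rightarrow> real \<Rightarrow> bool" where
  "conley_moser_1 L R H V \<mu>h \<mu>v \<longleftrightarrow>
     0 \<le> \<mu>v * \<mu>h \<and> \<mu>v * \<mu>h < 1 \<and>
     (\<forall>n. \<forall>i\<in>{1, 2}. L n ` V n i = H (n + 1) i) \<and>
     (\<forall>n. \<forall>i\<in>{1, 2}. \<forall>j\<in>{1, 2}. transition H V n i j = 1 \<longrightarrow>
        horizontal_strip_in R \<mu>h {-R..R} (V (n + 1) j) (Htrans H V n i j) \<and>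
        (\<exists>g. homeomorphism (Vtrans L V n j i) (Htrans H V n i j) (L n) g) \<and>
        L n -` hbd_in {-R..R} (V (n + 1) j) (Htrans H V n i j) \<subseteq> hbd_vstrip {-R..R} (V n i))"

text \<open>Cones are sets of tangent vectors, a tangent vector being a pair of a base point and a
  vector; \<open>tangent_map f\<close> is the induced map.\<close>

definition stable_cones :: "real \<Rightarrow> (real \<times> real) set \<Rightarrow> ((real \<times> real) \<times> (real \<times> real)) set" where
  "stable_cones \<mu>v K = {(z, (\<xi>, \<eta>)). z \<in> K \<and> \<bar>\<xi>\<bar> \<le> \<mu>v * \<bar>\<eta>\<bar>}"

definition unstable_cones :: "real \<Rightarrow> (real \<times> real) set \<Rightarrow> ((real \<times> real) \<times> (real \<times> real)) set" where
  "unstable_cones \<mu>h K = {(z, (\<xi>, \<eta>)). z \<in> K \<and> \<bar>\<eta>\<bar> \<le> \<mu>h * \<bar>\<xi>\<bar>}"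

definition tangent_map ::
  "(real \<times> real \<Rightarrow> real \<times> real) \<Rightarrow>
   (real \<times> real) \<times> (real \<times> real) \<Rightarrow> (real \<times> real) \<times> (real \<times> real)" where
  "tangent_map f = (\<lambda>(z, w). (f z, frechet_derivative f (at z) w))"

definition conley_moser_3 ::
  "(int \<Rightarrow> real \<times> real \<Rightarrow> real \<times> real) \<Rightarrow> (int \<Rightarrow> nat \<Rightarrow> (real \<times> real) set) \<Rightarrow>
   real \<Rightarrow> real \<Rightarrow> real \<Rightarrow> bool" where
  "conley_moser_3 L V \<mu>h \<mu>v \<mu> \<longleftrightarrow> (\<forall>n.
     (\<forall>z\<in>Vcal L V n. L n differentiable (at z)) \<and>
     (\<forall>z\<in>Hcal L V (n + 1). inv (L n) differentiable (at z)) \<and>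
     tangent_map (L n) ` unstable_cones \<mu>h (Vcal L V n) \<subseteq> unstable_cones \<mu>h (Hcal L V (n + 1)) \<and>
     tangent_map (inv (L n)) ` stable_cones \<mu>v (Hcal L V (n + 1)) \<subseteq> stable_cones \<mu>v (Vcal L V n) \<and>
     (\<forall>z\<in>Vcal L V n. \<forall>w. tangent_map (L n) (z, w) \<in> unstable_cones \<mu>h (Hcal L V (n + 1)) \<longrightarrow>
        \<bar>fst (frechet_derivative (L n) (at z) w)\<bar> \<ge> 1 / \<mu> * \<bar>fst w\<bar>) \<and>
     (\<forall>z\<in>Hcal L V (n + 1). \<forall>w. tangent_map (inv (L n)) (z, w) \<in> stable_cones \<mu>v (Vcal L V n) \<longrightarrow>
        \<bar>snd (frechet_derivative (inv (L n)) (at z) w)\<bar> \<ge> 1 / \<mu> * \<bar>snd w\<bar>))"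

text \<open>A pointed sequence $(\cdots s_{n-1}.s_n s_{n+1}\cdots)$ at time \<open>n\<close> is represented with the
  point at the origin, as the function sending \<open>k\<close> to $s_{n+k}$, so the admissibility condition
  at position \<open>k\<close> involves $A^{n+k}$ and moving the point one place to the right is the usual
  shift. The topology is the product topology that \<open>int \<Rightarrow> nat\<close> carries in the library, with
  \<open>nat\<close> discrete.\<close>

definition symbol_space :: "(int \<Rightarrow> nat \<Rightarrow> nat \<Rightarrow> nat) \<Rightarrow> int \<Rightarrow> (int \<Rightarrow> nat) set" where
  "symbol_space A n = {s. \<forall>k. s k \<in> {1, 2} \<and> A (n + k) (s k) (s (k + 1)) = 1}"

definition shift :: "(int \<Rightarrow> nat) \<Rightarrow> int \<Rightarrow> nat" where
  "shift s = (\<lambda>k. s (k + 1))"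

definition orbits :: "(int \<Rightarrow> 'a \<Rightarrow> 'a) \<Rightarrow> (int \<Rightarrow> 'a set) \<Rightarrow> (int \<Rightarrow> 'a) set" where
  "orbits L \<Lambda> = {z. \<forall>n. z n \<in> \<Lambda> n \<and> z (n + 1) = L n (z n)}"

text \<open>\<open>evolution L n k\<close> is $L_{n+k-1} \circ \cdots \circ L_n$.\<close>

primrec evolution :: "(int \<Rightarrow> 'a \<Rightarrow> 'a) \<Rightarrow> int \<Rightarrow> nat \<Rightarrow> 'a \<Rightarrow> 'a" where
  "evolution L n 0 = id"
| "evolution L n (Suc k) = L (n + int k) \<circ> evolution L n k"

text \<open>Products of \<open>k\<close> derivatives along the orbit \<open>z\<close>, applied to tangent vectors at \<open>z n\<close>:
  of the maps in forward time, and of their inverses in backward time.\<close>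

primrec forward_cocycle ::
  "(int \<Rightarrow> real \<times> real \<Rightarrow> real \<times> real) \<Rightarrow> (int \<Rightarrow> real \<times> real) \<Rightarrow> int \<Rightarrow> nat \<Rightarrow>
   real \<times> real \<Rightarrow> real \<times> real" where
  "forward_cocycle L z n 0 = id"
| "forward_cocycle L z n (Suc k) =
     frechet_derivative (L (n + int k)) (at (z (n + int k))) \<circ> forward_cocycle L z n k"

primrec backward_cocycle ::
  "(int \<Rightarrow> real \<times> real \<Rightarrow> real \<times> real) \<Rightarrow> (int \<Rightarrow> real \<times> real) \<Rightarrow> int \<Rightarrow> nat \<Rightarrow>
   real \<times> real \<Rightarrow> real \<times> real" where
  "backward_cocycle L z n 0 = id"
| "backward_cocycle L z n (Suc k) =
     frechet_derivative (inv (L (n - int k - 1))) (at (z (n - int k))) \<circ> backward_cocycle L z n k"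

definition saddle_type ::
  "(int \<Rightarrow> real \<times> real \<Rightarrow> real \<times> real) \<Rightarrow> (int \<Rightarrow> real \<times> real) \<Rightarrow> bool" where
  "saddle_type L z \<longleftrightarrow>
     (\<forall>n. L n differentiable (at (z n)) \<and> inv (L n) differentiable (at (z (n + 1)))) \<and>
     (\<exists>Es Eu C r. 0 < C \<and> 0 < r \<and> r < 1 \<and>
        (\<forall>n. subspace (Es n) \<and> dim (Es n) = 1 \<and> subspace (Eu n) \<and> dim (Eu n) = 1 \<and>
             Es n \<inter> Eu n = {0} \<and> {u + v | u v. u \<in> Es n \<and> v \<in> Eu n} = UNIV \<and>
             frechet_derivative (L n) (at (z n)) ` Es n = Es (n + 1) \<and>
             frechet_derivative (L n) (at (z n)) ` Eu n = Eu (n + 1) \<and>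
             (\<forall>v\<in>Es n. \<forall>k. norm (forward_cocycle L z n k v) \<le> C * r ^ k * norm v) \<and>
             (\<forall>v\<in>Eu n. \<forall>k. norm (backward_cocycle L z n k v) \<le> C * r ^ k * norm v)))"

definition sensitive_dependence :: "(int \<Rightarrow> 'a \<Rightarrow> 'a) \<Rightarrow> (int \<Rightarrow> 'a::metric_space set) \<Rightarrow> bool" where
  "sensitive_dependence L \<Lambda> \<longleftrightarrow>
     (\<exists>\<delta>>0. \<forall>n. \<forall>z\<in>\<Lambda> n. \<forall>U. open U \<and> z \<in> U \<longrightarrow>
        (\<exists>z'\<in>U \<inter> \<Lambda> n. \<exists>k\<ge>1. dist (evolution L n k z) (evolution L n k z') \<ge> \<delta>))"

end

theory Submission
  imports Defs
begin

text \<open>Every coefficient $a(n)$ is at least \<open>a > 4\<close> and (for \<open>\<epsilon> < 1\<close>) at most \<open>a + 2\<close>, so all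
  estimates are uniform in \<open>n\<close>, with $\mu_h = \mu_v = \mu = 1/2$. The strips are bounded by lines
  of slope at most \<open>1/4\<close>, so each $H^{n+1}_{ij}$ is a parallelogram, and it stays away from the
  lines \<open>y = R\<close> and \<open>y = -R\<close> because \<open>1 + 2 R < a R\<close>. The cone conditions hold since
  \<open>a - 1/2 \<ge> 2\<close>.

  An orbit in the square is a solution of $x_{n+1} + x_{n-1} = 1 - a(n) |x_n|$ bounded by \<open>R\<close>, and
  \<open>2 R < 1\<close> forces $x_n \neq 0$. Once the signs of the $x_n$ are prescribed, solving for $x_n$ gives
  a contraction of the sequences bounded by \<open>R\<close>, so every sequence of signs has exactly one orbit.
  The set of solutions is compact in the product topology, hence evaluation at time \<open>n\<close> and the
  itinerary are both homeomorphisms, and together they give the coding map. The invariant line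
  fields are fixed points of a second contraction, and sensitivity follows by changing one distant
  future symbol.\<close>

subsection \<open>A fixed-point theorem for bounded sequences\<close>

text \<open>Banach's fixed-point theorem for the supremum distance on the box of functions bounded
  by \<open>r\<close>; letting \<open>d\<close> be any common bound of the differences avoids
  suprema. Two points of the box differ by at most \<open>2 * r\<close>, so the iterates of the zero
  function converge at the rate \<open>c ^ k * (2 * r)\<close>.\<close>

lemma box_contraction_fixpoint:
  fixes T :: "('i \<Rightarrow> real) \<Rightarrow> 'i \<Rightarrow> real"
  assumes c: "0 \<le> c" "c < 1" and r: "0 \<le> r"
    and box: "\<And>u n. (\<And>n. \<bar>u n\<bar> \<le> r) \<Longrightarrow> \<bar>T u n\<bar> \<le> r"
    and contr: "\<And>u v d n. (\<And>n. \<bar>u n\<bar> \<le> r) \<Longrightarrow> (\<And>n. \<bar>v n\<bar> \<le> r) \<Longrightarrow>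
      (\<And>n. \<bar>u n - v n\<bar> \<le> d) \<Longrightarrow> \<bar>T u n - T v n\<bar> \<le> c * d"
  shows "\<exists>!u. (\<forall>n. \<bar>u n\<bar> \<le> r) \<and> T u = u"
proof -
  have box_iter: "\<bar>(T ^^ k) v n\<bar> \<le> r" if "\<And>n. \<bar>v n\<bar> \<le> r" for k v n
    by (induction k arbitrary: n) (use that box in auto)
  have contr_iter: "\<bar>(T ^^ k) v n - (T ^^ k) w n\<bar> \<le> c ^ k * (2 * r)"
    if v: "\<And>n. \<bar>v n\<bar> \<le> r" and w: "\<And>n. \<bar>w n\<bar> \<le> r" for k v w n
  proof (induction k arbitrary: n)
    case 0
    show ?case using v[of n] w[of n] by simp
  next
    case (Suc k)
    show ?case
      using contr[OF box_iter[OF v] box_iter[OF w] Suc.IH] by (simp add: mult.assoc)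
  qed
  define x where "x k = (T ^^ k) (\<lambda>_. 0)" for k
  have x_box: "\<bar>x k n\<bar> \<le> r" for k n
    unfolding x_def by (rule box_iter) (use r in simp)
  have pow0: "(\<lambda>k. c ^ k * (2 * r)) \<longlonglongrightarrow> 0"
    by (rule tendsto_mult_left_zero, rule LIMSEQ_power_zero) (use c in simp)
  have lim_unique: "(\<lambda>k. x k n) \<longlonglongrightarrow> t" if "\<And>k. \<bar>x k n - t\<bar> \<le> c ^ k * (2 * r)" for n t
    by (rule LIM_zero_cancel, rule Lim_null_comparison[OF _ pow0]) (use that in auto)
  \<comment> \<open>\<open>x (k + m)\<close> and \<open>x k\<close> are the \<open>k\<close>-fold
    images of \<open>x m\<close> and of the zero function, both in the box, so
    \<open>contr_iter\<close> applies without summing a geometric series.\<close>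
  have x_diff: "\<bar>x (k + m) n - x k n\<bar> \<le> c ^ k * (2 * r)" for k m n
    using contr_iter[OF x_box[of m], where w = "\<lambda>_. 0" and k = k and n = n] r by (simp add: x_def funpow_add)
  have "Cauchy (\<lambda>k. x k n)" for n
  proof (rule metric_CauchyI)
    fix e :: real assume "0 < e"
    then obtain N where N: "\<bar>c ^ k * (2 * r)\<bar> < e / 2" if "N \<le> k" for k
      using LIMSEQ_D[OF pow0, of "e / 2"] by auto
    have near: "dist (x k n) (x N n) < e / 2" if "N \<le> k" for k
    proof -
      have "dist (x k n) (x N n) \<le> c ^ N * (2 * r)"
        using x_diff[of N "k - N" n] that by (simp add: dist_real_def)
      also have "\<dots> < e / 2"
        using N[OF order_refl] by (rule le_less_trans[OF abs_ge_self])
      finally show ?thesis .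
    qed
    show "\<exists>N. \<forall>k\<ge>N. \<forall>l\<ge>N. dist (x k n) (x l n) < e"
      using near dist_triangle_half_l[of _ "x N n" e] by blast
  qed
  then have "\<exists>t. (\<lambda>k. x k n) \<longlonglongrightarrow> t" for n
    using real_Cauchy_convergent convergent_def by blast
  then obtain u where u: "\<And>n. (\<lambda>k. x k n) \<longlonglongrightarrow> u n"
    by metis
  have u_box: "\<bar>u n\<bar> \<le> r" for n
    by (rule LIMSEQ_le_const2[OF tendsto_rabs[OF u]]) (use x_box in auto)
  have u_diff: "\<bar>u n - x k n\<bar> \<le> c ^ k * (2 * r)" for k n
  proof (rule LIMSEQ_le_const2)
    show "(\<lambda>m. \<bar>x (m + k) n - x k n\<bar>) \<longlonglongrightarrow> \<bar>u n - x k n\<bar>"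
      by (intro tendsto_intros LIMSEQ_ignore_initial_segment u)
    show "\<exists>N. \<forall>m\<ge>N. \<bar>x (m + k) n - x k n\<bar> \<le> c ^ k * (2 * r)"
      using x_diff[of k _ n] by (auto simp: add.commute)
  qed
  \<comment> \<open>Pointwise convergence alone says nothing about \<open>T u\<close>. Since
    \<open>u_diff\<close> is uniform in the index, \<open>contr\<close> applies with
    \<open>d = c ^ k * (2 * r)\<close>.\<close>
  have "T u n = u n" for n
  proof -
    have "\<bar>T u n - x (Suc k) n\<bar> \<le> c ^ Suc k * (2 * r)" for k
      using contr[OF u_box x_box u_diff, where n = n] by (simp add: x_def mult.assoc)
    then have "(\<lambda>k. x (Suc k) n) \<longlonglongrightarrow> T u n"
      by (intro LIM_zero_cancel[of _ "T u n"], intro Lim_null_comparison[OF _ LIMSEQ_Suc[OF pow0]])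
         (simp add: abs_minus_commute)
    then show ?thesis
      using LIMSEQ_Suc[OF u] LIMSEQ_unique by blast
  qed
  moreover have "v = u" if v: "\<And>n. \<bar>v n\<bar> \<le> r" "T v = v" for v
  proof
    fix n
    have "(T ^^ k) v = v" for k
      by (induction k) (use v in auto)
    then have "\<bar>x k n - v n\<bar> \<le> c ^ k * (2 * r)" for k
      using contr_iter[where v = "\<lambda>_. 0" and w = v and k = k and n = n] v(1) r by (simp add: x_def)
    then show "v n = u n"
      using lim_unique u LIMSEQ_unique by blast
  qed
  ultimately show ?thesis
    using u_box by (intro ex1I[of _ u]) auto
qed

subsection \<open>The Lozi map and its derivative\<close>

lemma lozi_inv_lozi [simp]: "lozi c (inv (lozi c) z) = z"
  and inv_lozi_lozi [simp]: "inv (lozi c) (lozi c z) = z"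
  using bij_lozi by (simp_all add: surj_f_inv_f bij_is_surj bij_is_inj)

lemma mem_lozi_image: "(x, y) \<in> lozi c ` A \<longleftrightarrow> (- y, x + c * \<bar>y\<bar> - 1) \<in> A"
proof -
  have "(x, y) \<in> lozi c ` A \<longleftrightarrow> inv (lozi c) (x, y) \<in> A"
    by (metis image_iff lozi_inv_lozi inv_lozi_lozi)
  then show ?thesis by (simp add: inv_lozi)
qed

lemma continuous_on_lozi: "continuous_on A (lozi c)" "continuous_on A (inv (lozi c))"
  unfolding inv_lozi unfolding lozi_def case_prod_unfold by (intro continuous_intros)+

text \<open>The sign of \<open>x\<close> on $V^n_i$, opposite to the sign of \<open>y\<close> on $H^n_i$.\<close>

definition sym_sign :: "nat \<Rightarrow> real" where
  "sym_sign i = (if i = 1 then -1 else 1)"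

lemma abs_sym_sign [simp]: "\<bar>sym_sign i\<bar> = 1" and sym_sign_square [simp]: "sym_sign i * sym_sign i = 1"
  by (auto simp: sym_sign_def)

lemma open_same_sgn: "open {t :: real. sgn t = sgn x}" if "x \<noteq> 0"
proof -
  have "{t. sgn t = sgn x} = (if 0 < x then {0<..} else {..<0})"
    using that by (auto simp: sgn_if split: if_splits)
  then show ?thesis by simp
qed

text \<open>The map bends only along \<open>x = 0\<close>. On the open half-plane where the first
  coordinate keeps the sign it has at \<open>z\<close>, freezing that sign turns the map into an
  affine one. The inverse bends along \<open>y = 0\<close> and is treated alike.\<close>

lemma lozi_has_derivative:
  assumes "fst z \<noteq> 0"
  shows "(lozi c has_derivative (\<lambda>w. (snd w - c * sgn (fst z) * fst w, - fst w))) (at z)"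
proof (rule has_derivative_transform_within_open)
  show "((\<lambda>w. (1 + snd w - c * sgn (fst z) * fst w, - fst w)) has_derivative
      (\<lambda>w. (snd w - c * sgn (fst z) * fst w, - fst w))) (at z)"
    by (rule derivative_eq_intros refl | simp add: fun_eq_iff)+
  show "open (fst -` {t. sgn t = sgn (fst z)})"
    using assms by (intro open_vimage open_same_sgn continuous_on_fst continuous_on_id)
qed (auto simp: lozi_def sgn_if split: if_splits)

lemma inv_lozi_has_derivative:
  assumes "snd z \<noteq> 0"
  shows "(inv (lozi c) has_derivative (\<lambda>w. (- snd w, fst w + c * sgn (snd z) * snd w))) (at z)"
proof (rule has_derivative_transform_within_open)
  show "((\<lambda>w. (- snd w, fst w + c * sgn (snd z) * snd w - 1)) has_derivative
      (\<lambda>w. (- snd w, fst w + c * sgn (snd z) * snd w))) (at z)"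
    by (rule derivative_eq_intros refl | simp add: fun_eq_iff)+
  show "open (snd -` {t. sgn t = sgn (snd z)})"
    using assms by (intro open_vimage open_same_sgn continuous_on_snd continuous_on_id)
qed (auto simp: inv_lozi sgn_if split: if_splits)

lemma frechet_lozi: "fst z \<noteq> 0 \<Longrightarrow>
    frechet_derivative (lozi c) (at z) = (\<lambda>w. (snd w - c * sgn (fst z) * fst w, - fst w))"
  using frechet_derivative_at[OF lozi_has_derivative] by metis

lemma frechet_inv_lozi: "snd z \<noteq> 0 \<Longrightarrow>
    frechet_derivative (inv (lozi c)) (at z) = (\<lambda>w. (- snd w, fst w + c * sgn (snd z) * snd w))"
  using frechet_derivative_at[OF inv_lozi_has_derivative] by metis

subsection \<open>Strips bounded by lines\<close>

text \<open>The centre line is \<open>x = l * y + m\<close> and \<open>d\<close> is the horizontal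
  half-width. The range of \<open>y\<close> is left free, so a band is an intersection of two
  half-planes and a crossing of two bands can be a parallelogram.\<close>

definition vband :: "real \<Rightarrow> real \<Rightarrow> real \<Rightarrow> (real \<times> real) set" where
  "vband l m d = {(x, y). \<bar>x - l * y - m\<bar> \<le> d}"

definition hband :: "real \<Rightarrow> real \<Rightarrow> real \<Rightarrow> (real \<times> real) set" where
  "hband p q e = {(x, y). \<bar>y - p * x - q\<bar> \<le> e}"

lemma vband_eq: "vband l m d = {z. (1, - l) \<bullet> z \<le> m + d} \<inter> {z. (1, - l) \<bullet> z \<ge> m - d}"
  and hband_eq: "hband p q e = {z. (- p, 1) \<bullet> z \<le> q + e} \<inter> {z. (- p, 1) \<bullet> z \<ge> q - e}"
  by (auto simp: vband_def hband_def inner_prod_def algebra_simps abs_le_iff)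

lemma convex_band: "convex (vband l m d)" "convex (hband p q e)"
  unfolding vband_eq hband_eq by (intro convex_Int convex_halfspace_le convex_halfspace_ge)+

lemma closed_band: "closed (vband l m d)" "closed (hband p q e)"
  unfolding vband_eq hband_eq by (intro closed_Int closed_halfspace_le closed_halfspace_ge)+

lemma interior_vband: "interior (vband l m d) = {(x, y). \<bar>x - l * y - m\<bar> < d}"
  unfolding vband_eq interior_Int
  by (subst interior_halfspace_le, simp add: zero_prod_def, subst interior_halfspace_ge,
      simp add: zero_prod_def, auto simp: inner_prod_def algebra_simps abs_less_iff)

lemma interior_hband: "interior (hband p q e) = {(x, y). \<bar>y - p * x - q\<bar> < e}"
  unfolding hband_eq interior_Int
  by (subst interior_halfspace_le, simp add: zero_prod_def, subst interior_halfspace_ge,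
      simp add: zero_prod_def, auto simp: inner_prod_def algebra_simps abs_less_iff)

lemma lipschitz_on_affine: "\<bar>l\<bar> \<le> \<mu> \<Longrightarrow> \<mu>-lipschitz_on I (\<lambda>t :: real. l * t + m)"
  by (rule lipschitz_onI)
     (auto simp: dist_real_def right_diff_distrib[symmetric] abs_mult intro: mult_right_mono)

lemma vertical_strip_vband:
  assumes "0 < R" "0 < d" "\<bar>l\<bar> \<le> \<mu>"
    and sub: "{(x, y). \<bar>y\<bar> \<le> R} \<inter> vband l m d \<subseteq> square R"
  shows "vertical_strip R \<mu> {-R..R} ({(x, y). \<bar>y\<bar> \<le> R} \<inter> vband l m d)"
proof -
  have curve: "vertical_curve R \<mu> {-R..R} (\<lambda>t. l * t + m')" if "\<bar>m' - m\<bar> \<le> d" for m'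
    unfolding vertical_curve_def
  proof (intro conjI lipschitz_on_affine)
    show "vgraph (\<lambda>t. l * t + m') {-R..R} \<subseteq> square R"
      using that sub by (fastforce simp: vgraph_def vband_def abs_le_iff)
  qed (use assms in \<open>auto simp: closed_interval_def\<close>)
  show ?thesis
    unfolding vertical_strip_def
    by (rule exI[of _ "\<lambda>t. l * t + (m - d)"], rule exI[of _ "\<lambda>t. l * t + (m + d)"])
       (use curve[of "m - d"] curve[of "m + d"] assms(2) in \<open>auto simp: vband_def\<close>)
qed

lemma horizontal_strip_hband:
  assumes "0 < R" "0 < e" "\<bar>p\<bar> \<le> \<mu>"
    and sub: "{(x, y). \<bar>x\<bar> \<le> R} \<inter> hband p q e \<subseteq> square R"
  shows "horizontal_strip R \<mu> {-R..R} ({(x, y). \<bar>x\<bar> \<le> R} \<inter> hband p q e)"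
proof -
  have curve: "horizontal_curve R \<mu> {-R..R} (\<lambda>t. p * t + q')" if "\<bar>q' - q\<bar> \<le> e" for q'
    unfolding horizontal_curve_def
  proof (intro conjI lipschitz_on_affine)
    show "hgraph (\<lambda>t. p * t + q') {-R..R} \<subseteq> square R"
      using that sub by (fastforce simp: hgraph_def hband_def abs_le_iff)
  qed (use assms in \<open>auto simp: closed_interval_def\<close>)
  show ?thesis
    unfolding horizontal_strip_def
    by (rule exI[of _ "\<lambda>t. p * t + (q - e)"], rule exI[of _ "\<lambda>t. p * t + (q + e)"])
       (use curve[of "q - e"] curve[of "q + e"] assms(2) in \<open>auto simp: hband_def\<close>)
qed

text \<open>The frontier of the closed set \<open>K\<close> consists of the points where one of the
  two band inequalities is an equality. By \<open>sub\<close> the sides on the border of the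
  \<open>vband\<close> avoid \<open>y = R\<close> and \<open>y = - R\<close>, so they lie in the
  vertical boundary of \<open>V\<close>; the sides on the other two lines are the required
  graphs.\<close>

lemma band_intersection:
  assumes R: "0 < R" and d: "0 < d" and e: "0 < e" and p: "\<bar>p\<bar> \<le> \<mu>" and lp: "l * p < 1"
    and V: "V = {(x, y). \<bar>y\<bar> \<le> R} \<inter> vband l m d"
    and K: "K = vband l m d \<inter> hband p q e"
    and sub: "K \<subseteq> {(x, y). \<bar>x\<bar> \<le> R \<and> \<bar>y\<bar> < R}"
  shows "horizontal_strip_in R \<mu> {-R..R} V K"
    and "hbd_in {-R..R} V K \<subseteq> {(x, y). (x, y) \<in> K \<and> \<bar>y - p * x - q\<bar> = e}"
proof -
  have intK: "interior K = {(x, y). \<bar>x - l * y - m\<bar> < d \<and> \<bar>y - p * x - q\<bar> < e}"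
    unfolding K by (auto simp: interior_vband interior_hband)
  have "convex K" "closed K"
    unfolding K by (intro convex_Int convex_band closed_Int closed_band)+
  then have frK: "frontier K = K - interior K"
    by (simp add: frontier_def)
  have K_bound: "\<bar>x\<bar> \<le> R" "\<bar>y\<bar> < R" if "(x, y) \<in> K" for x y
    using that sub by auto
  have KV: "K \<subseteq> V"
    using sub by (force simp: K V)
  \<comment> \<open>The centre of the parallelogram: the lines \<open>x = l * y + m\<close> and
    \<open>y = p * x + q\<close> meet at the abscissa \<open>x0\<close>.\<close>
  define x0 where "x0 = (l * q + m) / (1 - l * p)"
  have "(1 - l * p) * x0 = l * q + m"
    using lp by (simp add: x0_def)
  then have "(x0, p * x0 + q) \<in> interior K"
    using d e by (simp add: intK algebra_simps)
  then have ne: "interior K \<noteq> {}" by blast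
  have region: "closed_region K"
    unfolding closed_region_def
    using ne convex_connected[OF convex_interior[OF \<open>convex K\<close>]]
      convex_closure_interior[OF \<open>convex K\<close> ne] \<open>closed K\<close> by simp
  have side: "(x, y) \<in> vbd_vstrip {-R..R} V" if "(x, y) \<in> K" "\<bar>x - l * y - m\<bar> = d" for x y
  proof -
    have "\<bar>y\<bar> < R" using K_bound(2) that(1) .
    then have "y \<notin> frontier {-R..R}"
      using R by (auto simp: frontier_def)
    moreover have "(x, y) \<notin> interior V"
      using interior_mono[of V "vband l m d"] that(2) by (auto simp: V interior_vband)
    ultimately show ?thesis
      using KV that(1) R by (auto simp: vbd_vstrip_def hbd_vstrip_def frontier_def[of V]
          intro: closure_subset[THEN subsetD])
  qed
  \<comment> \<open>The abscissas at which the line \<open>y = p * x + q'\<close> runs inside the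
    \<open>vband\<close>. They depend on \<open>q'\<close>, so the two bounding graphs have
    different domains.\<close>
  define J where "J q' = {(l * q' + m - d) / (1 - l * p)..(l * q' + m + d) / (1 - l * p)}" for q'
  have J_iff: "x \<in> J q' \<longleftrightarrow> \<bar>x - l * (p * x + q') - m\<bar> \<le> d" for x q'
    using lp by (auto simp: J_def pos_divide_le_eq pos_le_divide_eq abs_le_iff algebra_simps)
  have graph: "hgraph (\<lambda>t. p * t + q') (J q') = {(x, y). (x, y) \<in> K \<and> y = p * x + q'}"
    if "\<bar>q' - q\<bar> \<le> e" for q'
    using that by (auto simp: hgraph_def J_iff K vband_def hband_def)
  have graphs: "hgraph (\<lambda>t. p * t + (q - e)) (J (q - e)) = {(x, y). (x, y) \<in> K \<and> y = p * x + (q - e)}"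
     "hgraph (\<lambda>t. p * t + (q + e)) (J (q + e)) = {(x, y). (x, y) \<in> K \<and> y = p * x + (q + e)}"
    by (rule graph; use e in simp)+
  have curve: "horizontal_curve R \<mu> (J q') (\<lambda>t. p * t + q')" if "\<bar>q' - q\<bar> \<le> e" for q'
    unfolding horizontal_curve_def
  proof (intro conjI lipschitz_on_affine)
    have "(l * q' + m - d) / (1 - l * p) < (l * q' + m + d) / (1 - l * p)"
      by (rule divide_strict_right_mono) (use d lp in auto)
    then show "closed_interval (J q')"
      unfolding closed_interval_def J_def by blast
    show "hgraph (\<lambda>t. p * t + q') (J q') \<subseteq> square R"
      unfolding graph[OF that] square_def using K_bound by (force simp: abs_le_iff)
  qed (rule p)
  have boundary: "\<bar>x - l * y - m\<bar> = d \<or> \<bar>y - p * x - q\<bar> = e" "(x, y) \<in> K"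
    if "(x, y) \<in> frontier K" for x y
  proof -
    show xy: "(x, y) \<in> K" using that by (simp add: frK)
    have "\<not> (\<bar>x - l * y - m\<bar> < d \<and> \<bar>y - p * x - q\<bar> < e)"
      using that by (simp add: frK intK)
    moreover have "\<bar>x - l * y - m\<bar> \<le> d" "\<bar>y - p * x - q\<bar> \<le> e"
      using xy by (simp_all add: K vband_def hband_def)
    ultimately show "\<bar>x - l * y - m\<bar> = d \<or> \<bar>y - p * x - q\<bar> = e"
      by linarith
  qed
  have front: "frontier K - (hgraph (\<lambda>t. p * t + (q - e)) (J (q - e)) \<union>
      hgraph (\<lambda>t. p * t + (q + e)) (J (q + e))) \<subseteq> vbd_vstrip {-R..R} V"
  proof
    fix z assume z: "z \<in> frontier K - (hgraph (\<lambda>t. p * t + (q - e)) (J (q - e)) \<union>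
      hgraph (\<lambda>t. p * t + (q + e)) (J (q + e)))"
    obtain x y where xy: "z = (x, y)" by fastforce
    have "(x, y) \<in> K" "y \<noteq> p * x + (q - e)" "y \<noteq> p * x + (q + e)"
      using z boundary(2) unfolding xy graphs by auto
    moreover from this have "\<bar>x - l * y - m\<bar> = d"
      using z boundary(1)[of x y] unfolding xy by (auto simp: abs_if split: if_splits)
    ultimately show "z \<in> vbd_vstrip {-R..R} V"
      unfolding xy by (intro side)
  qed
  show "horizontal_strip_in R \<mu> {-R..R} V K"
    unfolding horizontal_strip_in_def
  proof (intro conjI exI)
    show "horizontal_curve R \<mu> (J (q - e)) (\<lambda>t. p * t + (q - e))"
      "horizontal_curve R \<mu> (J (q + e)) (\<lambda>t. p * t + (q + e))"
      by (rule curve; use e in simp)+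
    show "hgraph (\<lambda>t. p * t + (q - e)) (J (q - e)) \<subseteq> V"
      "hgraph (\<lambda>t. p * t + (q + e)) (J (q + e)) \<subseteq> V"
      using KV unfolding graphs by auto
    show "hgraph (\<lambda>t. p * t + (q - e)) (J (q - e)) \<inter> hgraph (\<lambda>t. p * t + (q + e)) (J (q + e)) = {}"
      using e unfolding graphs by auto
    show "hgraph (\<lambda>t. p * t + (q - e)) (J (q - e)) \<union> hgraph (\<lambda>t. p * t + (q + e)) (J (q + e))
      \<subseteq> frontier K"
      using e unfolding graphs frK intK by auto
  qed (fact region KV front)+
  show "hbd_in {-R..R} V K \<subseteq> {(x, y). (x, y) \<in> K \<and> \<bar>y - p * x - q\<bar> = e}"
  proof
    fix z assume z: "z \<in> hbd_in {-R..R} V K"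
    obtain x y where xy: "z = (x, y)" by fastforce
    have "(x, y) \<in> frontier K" "(x, y) \<notin> vbd_vstrip {-R..R} V"
      using z by (auto simp: hbd_in_def vbd_in_def xy)
    then show "z \<in> {(x, y). (x, y) \<in> K \<and> \<bar>y - p * x - q\<bar> = e}"
      using side[of x y] boundary[of x y] unfolding xy by blast
  qed
qed

subsection \<open>The Conley-Moser conditions\<close>

text \<open>The facts about the coefficients from which everything below follows: \<open>b_R\<close>
  sends coordinates solved from the recurrence back into the interval bounded by \<open>R\<close>,
  \<open>R_half\<close> keeps orbits off the line \<open>x = 0\<close>, and \<open>B\<close> makes
  their distance from it uniform in time.\<close>

locale lozi_family =
  fixes b :: "int \<Rightarrow> real" and R B :: real
  assumes R_pos: "0 < R" and R_half: "2 * R < 1"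
    and b_R: "\<And>n. 1 + 2 * R < b n * R" and b_le: "\<And>n. b n \<le> B"
begin

abbreviation "L \<equiv> \<lambda>n. lozi (b n)"
abbreviation "S \<equiv> square R"
abbreviation "H \<equiv> horiz_set L S"
abbreviation "V \<equiv> vert_set L S"

section \<open>Coefficient bounds and the strips as bands\<close>

lemma b_gt: "4 < b n"
proof (rule ccontr)
  assume "\<not> 4 < b n"
  then have "b n * R \<le> 4 * R" using R_pos by simp
  then show False using b_R[of n] R_half by linarith
qed

lemma b_pos: "0 < b n"
  using b_gt[of n] by linarith

lemma scaled_abs_le: "\<bar>u - s / b n * v - t / b n\<bar> \<le> R / b n \<longleftrightarrow> \<bar>b n * u - s * v - t\<bar> \<le> R"
proof -
  have "u - s / b n * v - t / b n = (b n * u - s * v - t) / b n"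
    using b_pos[of n] by (simp add: field_simps)
  then show ?thesis
    using b_pos[of n] by (simp add: divide_le_cancel)
qed

text \<open>The basic use of \<open>b_R\<close>: the hypotheses give
  \<open>b n * \<bar>u\<bar> \<le> 1 + 2 * R < b n * R\<close>.\<close>

lemma abs_less_R: "\<bar>u\<bar> < R" if "\<bar>b n * u - v\<bar> \<le> 1 + R" "\<bar>v\<bar> \<le> R"
proof -
  have "b n * \<bar>u\<bar> = \<bar>b n * u\<bar>"
    using b_pos[of n] by (simp add: abs_mult)
  also have "\<dots> < b n * R"
    using that b_R[of n] by linarith
  finally show ?thesis
    using b_pos[of n] by simp
qed

text \<open>On the strip \<open>\<bar>x\<bar> = sym_sign i * x\<close>, so the condition on the
  image becomes affine after multiplication by a sign. Conversely \<open>abs_less_R\<close> recovers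
  the bound on \<open>x\<close>, and \<open>1 - 2 * R > 0\<close> recovers its strict sign.\<close>

lemma vert_set_iff:
  assumes "i \<in> {1, 2}"
  shows "(x, y) \<in> V n i \<longleftrightarrow> \<bar>y\<bar> \<le> R \<and> \<bar>b n * x - sym_sign i * y - sym_sign i\<bar> \<le> R"
proof
  assume "(x, y) \<in> V n i"
  then show "\<bar>y\<bar> \<le> R \<and> \<bar>b n * x - sym_sign i * y - sym_sign i\<bar> \<le> R"
    by (auto simp: vert_set_def lozi_def square_def sym_sign_def abs_le_iff)
next
  assume *: "\<bar>y\<bar> \<le> R \<and> \<bar>b n * x - sym_sign i * y - sym_sign i\<bar> \<le> R"
  have "\<bar>sym_sign i * y\<bar> \<le> R"
    using * by (simp add: abs_mult)
  then have x: "\<bar>x\<bar> < R"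
    using * by (intro abs_less_R[of n x "sym_sign i * y"]) (auto simp: sym_sign_def abs_le_iff)
  have "0 < b n * (sym_sign i * x)"
    using * R_half assms by (auto simp: sym_sign_def abs_le_iff)
  then have "0 < sym_sign i * x"
    using b_pos[of n] by (simp add: zero_less_mult_iff)
  then show "(x, y) \<in> V n i"
    using * x assms by (auto simp: vert_set_def lozi_def square_def sym_sign_def abs_le_iff)
qed

text \<open>The same computation for the inverse map, with
  \<open>\<bar>y\<bar> = - sym_sign i * y\<close>; the strip at time \<open>n + 1\<close> comes from
  the coefficient \<open>b n\<close>.\<close>

lemma horiz_set_iff:
  assumes "i \<in> {1, 2}"
  shows "(x, y) \<in> H (n + 1) i \<longleftrightarrow> \<bar>x\<bar> \<le> R \<and> \<bar>b n * y - sym_sign i * x + sym_sign i\<bar> \<le> R"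
proof -
  show ?thesis
  proof
    assume "(x, y) \<in> H (n + 1) i"
    then show "\<bar>x\<bar> \<le> R \<and> \<bar>b n * y - sym_sign i * x + sym_sign i\<bar> \<le> R"
      by (auto simp: horiz_set_def mem_lozi_image square_def sym_sign_def abs_le_iff)
  next
    assume *: "\<bar>x\<bar> \<le> R \<and> \<bar>b n * y - sym_sign i * x + sym_sign i\<bar> \<le> R"
    have "\<bar>sym_sign i * x\<bar> \<le> R"
      using * by (simp add: abs_mult)
    then have y: "\<bar>y\<bar> < R"
      using * by (intro abs_less_R[of n y "sym_sign i * x"]) (auto simp: sym_sign_def abs_le_iff)
    have "b n * (sym_sign i * y) < 0"
      using * R_half assms by (auto simp: sym_sign_def abs_le_iff)
    then have "sym_sign i * y < 0"
      using b_pos[of n] by (simp add: mult_less_0_iff)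
    then show "(x, y) \<in> H (n + 1) i"
      using * y assms by (auto simp: horiz_set_def mem_lozi_image square_def sym_sign_def abs_le_iff)
  qed
qed

lemma vert_set_eq:
  assumes "i \<in> {1, 2}"
  shows "V n i = {(x, y). \<bar>y\<bar> \<le> R} \<inter> vband (sym_sign i / b n) (sym_sign i / b n) (R / b n)"
  using scaled_abs_le by (auto simp: vert_set_iff[OF assms] vband_def)

lemma horiz_set_eq:
  assumes "i \<in> {1, 2}"
  shows "H (n + 1) i = {(x, y). \<bar>x\<bar> \<le> R} \<inter> hband (sym_sign i / b n) (- sym_sign i / b n) (R / b n)"
  using scaled_abs_le[of _ _ n _ "- sym_sign i"] by (auto simp: horiz_set_iff[OF assms] hband_def)

lemma slope_le: "\<bar>sym_sign i / b n\<bar> \<le> 1/2"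
  using b_gt[of n] by (simp add: divide_le_eq)

lemma strips:
  assumes "i \<in> {1, 2}"
  shows "vertical_strip R (1/2) {-R..R} (V n i)" "horizontal_strip R (1/2) {-R..R} (H (n + 1) i)"
proof -
  have "V n i \<subseteq> S" "H (n + 1) i \<subseteq> S"
    by (auto simp: vert_set_def horiz_set_def)
  moreover have "0 < R / b n"
    using R_pos b_pos[of n] by simp
  ultimately show "vertical_strip R (1/2) {-R..R} (V n i)"
    "horizontal_strip R (1/2) {-R..R} (H (n + 1) i)"
    using R_pos slope_le unfolding vert_set_eq[OF assms] horiz_set_eq[OF assms]
    by (blast intro: vertical_strip_vband horizontal_strip_hband)+
qed

section \<open>Transition regions and the Conley-Moser conditions\<close>

lemma image_vert_set: "L n ` V n i = H (n + 1) i"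
  by (auto simp: set_eq_iff mem_lozi_image vert_set_def horiz_set_def lozi_def simp del: image_iff)

text \<open>The two bands alone already confine their crossing to the open square: if
  \<open>u\<close> is the larger of \<open>\<bar>x\<bar>\<close> and \<open>\<bar>y\<bar>\<close>,
  one band inequality yields \<open>(b m - 1) * u \<le> 1 + R < (b m - 1) * R\<close> for the
  corresponding index \<open>m\<close>. The side conditions of the strips are therefore
  automatic.\<close>

lemma Htrans_eq:
  fixes n :: int
  assumes i: "i \<in> {1, 2}" and j: "j \<in> {1, 2}"
  defines "K \<equiv> vband (sym_sign j / b (n + 1)) (sym_sign j / b (n + 1)) (R / b (n + 1)) \<inter>
    hband (sym_sign i / b n) (- sym_sign i / b n) (R / b n)"
  shows "Htrans H V n i j = K" and "K \<subseteq> {(x, y). \<bar>x\<bar> \<le> R \<and> \<bar>y\<bar> < R}"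
proof -
  have K: "\<bar>x\<bar> < R \<and> \<bar>y\<bar> < R" if "(x, y) \<in> K" for x y
  proof -
    have "\<bar>b (n + 1) * x - sym_sign j * y - sym_sign j\<bar> \<le> R"
      "\<bar>b n * y - sym_sign i * x + sym_sign i\<bar> \<le> R"
      using that scaled_abs_le[of _ _ n _ "- sym_sign i"] scaled_abs_le[of _ _ "n + 1"]
      by (auto simp: K_def vband_def hband_def)
    then have "\<bar>b (n + 1) * x\<bar> \<le> 1 + R + \<bar>y\<bar>" "\<bar>b n * y\<bar> \<le> 1 + R + \<bar>x\<bar>"
      by (auto simp: sym_sign_def split: if_splits)
    then have *: "b (n + 1) * \<bar>x\<bar> \<le> 1 + R + \<bar>y\<bar>" "b n * \<bar>y\<bar> \<le> 1 + R + \<bar>x\<bar>"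
      using b_pos by (simp_all add: abs_mult abs_of_pos)
    have less: "u < R" if "b m * u \<le> 1 + R + w" "w \<le> u" for m u w
    proof -
      have "(b m - 1) * u < (b m - 1) * R"
        using that b_R[of m] R_pos by (simp add: algebra_simps)
      then show ?thesis using b_gt[of m] by simp
    qed
    show ?thesis
      using less[OF *(1)] less[OF *(2)] by linarith
  qed
  then show "K \<subseteq> {(x, y). \<bar>x\<bar> \<le> R \<and> \<bar>y\<bar> < R}"
    using less_imp_le by blast
  show "Htrans H V n i j = K"
    unfolding Htrans_def vert_set_eq[OF j] horiz_set_eq[OF i] using K less_imp_le
    unfolding K_def by blast
qed

text \<open>Slopes at most \<open>1/2\<close> make the bands transversal, so
  \<open>band_intersection\<close> applies. The second part clears the denominator
  \<open>b n\<close>, giving the equation that pulls back under the map to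
  \<open>\<bar>y\<bar> = R\<close>.\<close>

lemma Htrans_strip:
  assumes i: "i \<in> {1, 2}" and j: "j \<in> {1, 2}"
  shows "horizontal_strip_in R (1/2) {-R..R} (V (n + 1) j) (Htrans H V n i j)"
    and "hbd_in {-R..R} (V (n + 1) j) (Htrans H V n i j) \<subseteq>
      {(x, y). (x, y) \<in> Htrans H V n i j \<and> \<bar>b n * y - sym_sign i * x + sym_sign i\<bar> = R}"
proof -
  have pos: "0 < R / b m" for m
    using R_pos b_pos[of m] by simp
  have "\<bar>sym_sign j / b (n + 1)\<bar> * \<bar>sym_sign i / b n\<bar> \<le> 1/2 * (1/2)"
    by (rule mult_mono[OF slope_le slope_le]) simp_all
  then have "(sym_sign j / b (n + 1)) * (sym_sign i / b n) \<le> 1/2 * (1/2)"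
    unfolding abs_mult[symmetric] by (rule order_trans[OF abs_ge_self])
  then have lp: "(sym_sign j / b (n + 1)) * (sym_sign i / b n) < 1"
    by linarith
  note band = band_intersection[OF R_pos pos pos slope_le lp vert_set_eq[OF j]
      Htrans_eq(1)[OF i j] Htrans_eq(2)[OF i j, folded Htrans_eq(1)[OF i j]]]
  show "horizontal_strip_in R (1/2) {-R..R} (V (n + 1) j) (Htrans H V n i j)"
    by (rule band(1))
  have "y - sym_sign i / b n * x - (- sym_sign i / b n) =
      (b n * y - sym_sign i * x + sym_sign i) / b n" for x y
    using b_pos[of n] by (simp add: field_simps)
  then have "\<bar>y - sym_sign i / b n * x - (- sym_sign i / b n)\<bar> = R / b n \<longleftrightarrow>
      \<bar>b n * y - sym_sign i * x + sym_sign i\<bar> = R" for x y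
    using b_pos[of n] by simp
  then show "hbd_in {-R..R} (V (n + 1) j) (Htrans H V n i j) \<subseteq>
      {(x, y). (x, y) \<in> Htrans H V n i j \<and> \<bar>b n * y - sym_sign i * x + sym_sign i\<bar> = R}"
    using band(2) by simp
qed

text \<open>A closed region has nonempty interior. All transitions are thus allowed and the symbol
  space is the full shift on two symbols.\<close>

lemma transition_eq_1:
  assumes "i \<in> {1, 2}" "j \<in> {1, 2}"
  shows "transition H V n i j = 1"
proof -
  have "Htrans H V n i j \<noteq> {}"
    using Htrans_strip(1)[OF assms, of n] by (auto simp: horizontal_strip_in_def closed_region_def)
  then show ?thesis by (simp add: transition_def)
qed

lemma conley_moser_1: "conley_moser_1 L R H V (1/2) (1/2)"
  unfolding conley_moser_1_def
proof (intro conjI allI ballI impI)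
  fix n i j assume i: "i \<in> {1, 2 :: nat}" and j: "j \<in> {1, 2 :: nat}"
  show "horizontal_strip_in R (1/2) {-R..R} (V (n + 1) j) (Htrans H V n i j)"
    by (rule Htrans_strip(1)[OF i j])
  have image: "L n ` Vtrans L V n j i = Htrans H V n i j"
    unfolding Vtrans_def Htrans_def image_vert_set[symmetric] by auto
  then have "homeomorphism (Vtrans L V n j i) (Htrans H V n i j) (L n) (inv (L n))"
    by (auto simp: homeomorphism_def continuous_on_lozi image_image simp flip: image)
  then show "\<exists>g. homeomorphism (Vtrans L V n j i) (Htrans H V n i j) (L n) g"
    by (rule exI[of _ "inv (L n)"])
  show "L n -` hbd_in {-R..R} (V (n + 1) j) (Htrans H V n i j) \<subseteq> hbd_vstrip {-R..R} (V n i)"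
  proof
    fix z assume z: "z \<in> L n -` hbd_in {-R..R} (V (n + 1) j) (Htrans H V n i j)"
    obtain x y where xy: "z = (x, y)" by fastforce
    have L: "L n z \<in> Htrans H V n i j"
      "\<bar>b n * snd (L n z) - sym_sign i * fst (L n z) + sym_sign i\<bar> = R"
      using z Htrans_strip(2)[OF i j, of n] by (auto simp: case_prod_unfold)
    then have "L n z \<in> L n ` V n i"
      unfolding image_vert_set by (simp add: Htrans_def)
    then have zV: "z \<in> V n i"
      using bij_is_inj[OF bij_lozi] by (simp add: inj_image_mem_iff)
    \<comment> \<open>With this identity the expression inside the absolute value of
      \<open>L(2)\<close> collapses to \<open>- sym_sign i * y\<close>.\<close>
    then have "\<bar>x\<bar> = sym_sign i * x"
      by (auto simp: xy vert_set_def sym_sign_def)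
    then have "\<bar>y\<bar> = R"
      using L(2) by (auto simp: xy lozi_def sym_sign_def split: if_splits)
    then show "z \<in> hbd_vstrip {-R..R} (V n i)"
      using zV R_pos by (auto simp: hbd_vstrip_def xy frontier_def)
  qed
qed (use image_vert_set in auto)

text \<open>The derivative sends \<open>(s, t)\<close> to \<open>(t - c * s, - s)\<close> with
  \<open>\<bar>c\<bar> > 4\<close>. Cone invariance is the estimate \<open>expand\<close>. The
  expansion claims need no further estimate: as the image vector has \<open>- s\<close> as second
  coordinate, its membership in the cone of slope \<open>1/2\<close> already says that the first
  coordinate is at least \<open>2 * \<bar>s\<bar>\<close> in size. The inverse is symmetric.\<close>

lemma conley_moser_3: "conley_moser_3 L V (1/2) (1/2) (1/2)"
proof -
  have cal: "Hcal L V (n + 1) = L n ` Vcal L V n" for n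
    by (auto simp: Hcal_def Vcal_def)
  have fst_ne: "fst z \<noteq> 0" if "z \<in> Vcal L V n" for z n
    using that by (auto simp: Vcal_def vert_set_def)
  have snd_ne: "snd z \<noteq> 0" if z: "z \<in> Hcal L V (n + 1)" for z n
  proof -
    obtain z' where "z' \<in> Vcal L V n" "z = L n z'"
      using z unfolding cal by blast
    then show ?thesis
      using fst_ne by (simp add: lozi_def case_prod_unfold)
  qed
  have expand: "2 * \<bar>s\<bar> \<le> \<bar>b n * sgn x * s + t\<bar>" "2 * \<bar>s\<bar> \<le> \<bar>t - b n * sgn x * s\<bar>"
    if "x \<noteq> 0" "\<bar>t\<bar> \<le> 1/2 * \<bar>s\<bar>" for x s t n
  proof -
    have "\<bar>b n * sgn x * s\<bar> = b n * \<bar>s\<bar>"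
      using that(1) b_pos[of n] by (simp add: abs_mult abs_sgn_eq)
    moreover have "4 * \<bar>s\<bar> \<le> b n * \<bar>s\<bar>"
      using b_gt[of n] by (intro mult_right_mono) auto
    ultimately show "2 * \<bar>s\<bar> \<le> \<bar>b n * sgn x * s + t\<bar>" "2 * \<bar>s\<bar> \<le> \<bar>t - b n * sgn x * s\<bar>"
      using that(2) by linarith+
  qed
  show ?thesis
    unfolding conley_moser_3_def
  proof (intro allI conjI ballI impI)
    fix n z assume "z \<in> Vcal L V n"
    then show "L n differentiable (at z)"
      using lozi_has_derivative fst_ne differentiableI by blast
  next
    fix n z assume "z \<in> Hcal L V (n + 1)"
    then show "inv (L n) differentiable (at z)"
      using inv_lozi_has_derivative snd_ne differentiableI by blast
  next
    fix n
    show "tangent_map (L n) ` unstable_cones (1/2) (Vcal L V n) \<subseteq>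
        unstable_cones (1/2) (Hcal L V (n + 1))"
    proof
      fix p assume "p \<in> tangent_map (L n) ` unstable_cones (1/2) (Vcal L V n)"
      then obtain z s t where z: "z \<in> Vcal L V n" and st: "\<bar>t\<bar> \<le> 1/2 * \<bar>s\<bar>"
        and p: "p = tangent_map (L n) (z, (s, t))"
        by (auto simp: unstable_cones_def)
      then show "p \<in> unstable_cones (1/2) (Hcal L V (n + 1))"
        using expand(2)[OF fst_ne[OF z] st, of n]
        by (simp add: p tangent_map_def unstable_cones_def cal frechet_lozi fst_ne)
    qed
    show "tangent_map (inv (L n)) ` stable_cones (1/2) (Hcal L V (n + 1)) \<subseteq>
        stable_cones (1/2) (Vcal L V n)"
    proof
      fix p assume "p \<in> tangent_map (inv (L n)) ` stable_cones (1/2) (Hcal L V (n + 1))"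
      then obtain z s t where z: "z \<in> Hcal L V (n + 1)" and st: "\<bar>s\<bar> \<le> 1/2 * \<bar>t\<bar>"
        and p: "p = tangent_map (inv (L n)) (z, (s, t))"
        by (auto simp: stable_cones_def)
      have "inv (L n) z \<in> Vcal L V n"
        using z by (auto simp: cal)
      then show "p \<in> stable_cones (1/2) (Vcal L V n)"
        using expand(1)[OF snd_ne[OF z] st, of n] z
        by (simp add: p tangent_map_def stable_cones_def frechet_inv_lozi snd_ne add.commute)
    qed
  next
    fix n z w assume "z \<in> Vcal L V n"
      "tangent_map (L n) (z, w) \<in> unstable_cones (1/2) (Hcal L V (n + 1))"
    then show "1 / (1/2) * \<bar>fst w\<bar> \<le> \<bar>fst (frechet_derivative (L n) (at z) w)\<bar>"
      by (simp add: tangent_map_def unstable_cones_def frechet_lozi fst_ne)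
  next
    fix n z w assume "z \<in> Hcal L V (n + 1)"
      "tangent_map (inv (L n)) (z, w) \<in> stable_cones (1/2) (Vcal L V n)"
    then show "1 / (1/2) * \<bar>snd w\<bar> \<le> \<bar>snd (frechet_derivative (inv (L n)) (at z) w)\<bar>"
      by (simp add: tangent_map_def stable_cones_def frechet_inv_lozi snd_ne)
  qed
qed

end

subsection \<open>Invariant line fields\<close>

text \<open>The recurrence satisfied by the slopes of a line field invariant under the derivative
  cocycle; the stable line field solves it after time reversal.\<close>

lemma exists_riccati_solution:
  fixes c :: "int \<Rightarrow> real"
  assumes c: "\<And>n. 4 \<le> \<bar>c n\<bar>"
  obtains u where "\<And>n. \<bar>u n\<bar> \<le> 1/2" "\<And>n. u (n + 1) * (c n + u n) = -1"
proof -
  define T where "T u n = - 1 / (c (n - 1) + u (n - 1))" for u :: "int \<Rightarrow> real" and n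
  \<comment> \<open>Denominators of size at least \<open>2\<close> give both values bounded by
    \<open>1/2\<close> and, via the difference quotient \<open>(p - q) / (p * q)\<close>, the
    contraction constant \<open>1/2\<close>.\<close>
  have den: "2 \<le> \<bar>c n + t\<bar>" if "\<bar>t\<bar> \<le> 1/2" for n t
    using c[of n] that by linarith
  have "\<exists>!u. (\<forall>n. \<bar>u n\<bar> \<le> 1/2) \<and> T u = u"
  proof (rule box_contraction_fixpoint[where c = "1/2"])
    fix u n assume u: "\<And>n :: int. \<bar>u n\<bar> \<le> (1/2 :: real)"
    show "\<bar>T u n\<bar> \<le> 1/2"
      using den[OF u, of "n - 1" "n - 1"] by (simp add: T_def divide_simps)
  next
    fix u v d n
    assume u: "\<And>n :: int. \<bar>u n\<bar> \<le> (1/2 :: real)" and v: "\<And>n :: int. \<bar>v n\<bar> \<le> (1/2 :: real)"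
      and d: "\<And>n. \<bar>u n - v n\<bar> \<le> d"
    define p q where "p = c (n - 1) + u (n - 1)" and "q = c (n - 1) + v (n - 1)"
    have pq: "2 \<le> \<bar>p\<bar>" "2 \<le> \<bar>q\<bar>" "\<bar>p - q\<bar> \<le> d"
      using den[OF u] den[OF v] d[of "n - 1"] by (auto simp: p_def q_def)
    have "2 \<le> \<bar>p * q\<bar>"
      using mult_mono[OF pq(1,2)] by (simp add: abs_mult)
    have "T u n - T v n = (p - q) / (p * q)"
      using pq by (auto simp: T_def p_def[symmetric] q_def[symmetric] divide_simps)
    then have "\<bar>T u n - T v n\<bar> = \<bar>p - q\<bar> / \<bar>p * q\<bar>"
      by simp
    also have "\<dots> \<le> d / 2"
      using \<open>2 \<le> \<bar>p * q\<bar>\<close> pq(3) by (intro frac_le) auto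
    finally show "\<bar>T u n - T v n\<bar> \<le> 1/2 * d" by simp
  qed auto
  then obtain u where u: "\<And>n. \<bar>u n\<bar> \<le> 1/2" "T u = u" by blast
  show thesis
  proof
    show "u (n + 1) * (c n + u n) = -1" for n
      using fun_cong[OF u(2), of "n + 1"] den[OF u(1), of n n] by (auto simp: T_def field_simps)
  qed (rule u(1))
qed

section \<open>Cocycles along invariant line fields and the saddle splitting\<close>

lemma linear_image_line:
  assumes "linear f" "f v = t *\<^sub>R w" "t \<noteq> 0"
  shows "f ` span {v} = span {w}"
proof -
  have "f ` span {v} = range (\<lambda>k. (k * t) *\<^sub>R w)"
    using assms by (auto simp: span_singleton linear_scale image_image)
  also have "range (\<lambda>k. (k * t) *\<^sub>R w) = (\<lambda>k. k *\<^sub>R w) ` range (\<lambda>k. k * t)"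
    by (simp add: image_image)
  also have "range (\<lambda>k. k * t) = UNIV"
    using assms(3) by (intro surjI[of _ "\<lambda>k. k / t"]) simp
  finally show ?thesis by (simp add: span_singleton)
qed

text \<open>On an invariant line field the cocycle acts by scalars: \<open>q\<close> is
  \<open>s\<close> times the product of \<open>k\<close> multipliers, each bounded by
  \<open>r\<close>.\<close>

lemma forward_cocycle_line:
  assumes step: "\<And>n. frechet_derivative (L n) (at (z n)) (w n) = t n *\<^sub>R w (n + 1)"
    and lin: "\<And>n. linear (frechet_derivative (L n) (at (z n)))"
    and t: "\<And>n. \<bar>t n\<bar> \<le> r"
  shows "\<exists>q. forward_cocycle L z n k (s *\<^sub>R w n) = q *\<^sub>R w (n + int k) \<and> \<bar>q\<bar> \<le> r ^ k * \<bar>s\<bar>"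
proof (induction k)
  case (Suc k)
  then obtain q where q: "forward_cocycle L z n k (s *\<^sub>R w n) = q *\<^sub>R w (n + int k)"
      "\<bar>q\<bar> \<le> r ^ k * \<bar>s\<bar>" by blast
  have "\<bar>t (n + int k) * q\<bar> \<le> r * (r ^ k * \<bar>s\<bar>)"
    unfolding abs_mult using t q(2) abs_ge_zero order_trans by (intro mult_mono) blast+
  then show ?case
    by (intro exI[of _ "t (n + int k) * q"])
       (simp add: q(1) linear_scale[OF lin] step mult.assoc mult.commute[of q] add.assoc add.commute[of 1])
qed (auto intro: exI[of _ s])

lemma backward_cocycle_line:
  assumes step: "\<And>n. frechet_derivative (inv (L (n - 1))) (at (z n)) (w n) = t n *\<^sub>R w (n - 1)"
    and lin: "\<And>n. linear (frechet_derivative (inv (L (n - 1))) (at (z n)))"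
    and t: "\<And>n. \<bar>t n\<bar> \<le> r"
  shows "\<exists>q. backward_cocycle L z n k (s *\<^sub>R w n) = q *\<^sub>R w (n - int k) \<and> \<bar>q\<bar> \<le> r ^ k * \<bar>s\<bar>"
proof (induction k)
  case (Suc k)
  have index: "n - int (Suc k) = n - int k - 1" by simp
  from Suc obtain q where q: "backward_cocycle L z n k (s *\<^sub>R w n) = q *\<^sub>R w (n - int k)"
      "\<bar>q\<bar> \<le> r ^ k * \<bar>s\<bar>" by blast
  have "\<bar>t (n - int k) * q\<bar> \<le> r * (r ^ k * \<bar>s\<bar>)"
    unfolding abs_mult using t q(2) abs_ge_zero order_trans by (intro mult_mono) blast+
  then show ?case
    by (intro exI[of _ "t (n - int k) * q"])
       (simp add: q(1) linear_scale[OF lin] step mult.assoc mult.commute[of q] index del: of_nat_Suc)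
qed (auto intro: exI[of _ s])

text \<open>The stable line is spanned by \<open>(p n, 1)\<close> and the unstable one by
  \<open>(1, u n)\<close>, where \<open>p\<close> and \<open>u\<close> solve Riccati recurrences.
  The forward multiplier is \<open>- p n\<close> and the backward one \<open>- u n\<close>, so the
  bound \<open>1/2\<close> on the slopes is itself the contraction rate.\<close>

lemma saddle_type_lozi:
  fixes b :: "int \<Rightarrow> real"
  assumes b: "\<And>n. 4 \<le> \<bar>b n\<bar>" and z: "\<And>n. fst (z n) \<noteq> 0" and orbit: "\<And>n. z (n + 1) = lozi (b n) (z n)"
  shows "saddle_type (\<lambda>n. lozi (b n)) z"
proof -
  have snd_z: "snd (z (n + 1)) = - fst (z n)" for n
    by (simp add: orbit lozi_def case_prod_unfold)
  define c where "c n = - b n * sgn (fst (z n))" for n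
  have c: "4 \<le> \<bar>c n\<bar>" for n
    using b z by (simp add: c_def abs_mult abs_sgn_eq)
  have D: "frechet_derivative (lozi (b n)) (at (z n)) = (\<lambda>w. (snd w + c n * fst w, - fst w))" for n
    by (simp add: frechet_lozi z c_def)
  have I: "frechet_derivative (inv (lozi (b n))) (at (z (n + 1))) = (\<lambda>w. (- snd w, fst w + c n * snd w))" for n
    by (simp add: frechet_inv_lozi z snd_z c_def sgn_minus)
  have I': "frechet_derivative (inv (lozi (b (n - 1)))) (at (z n)) =
      (\<lambda>w. (- snd w, fst w + c (n - 1) * snd w))" for n
    using I[of "n - 1"] by simp
  have diff: "lozi (b n) differentiable (at (z n))" "inv (lozi (b n)) differentiable (at (z (n + 1)))" for n
    using lozi_has_derivative[OF z] inv_lozi_has_derivative[of "z (n + 1)"] z snd_z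
    by (auto intro: differentiableI)
  have diff': "inv (lozi (b (n - 1))) differentiable (at (z n))" for n
    using diff(2)[of "n - 1"] by simp
  obtain u where u: "\<And>n. \<bar>u n\<bar> \<le> 1/2" "\<And>n. u (n + 1) * (c n + u n) = -1"
    using exists_riccati_solution[of c] c by blast
  \<comment> \<open>Time reversal: with the offset \<open>- n - 1\<close>, setting
    \<open>p n = v (- n)\<close> yields \<open>p n * (c n + p (n + 1)) = -1\<close>, the invariance
    equation of the stable line.\<close>
  obtain v where v: "\<And>n. \<bar>v n\<bar> \<le> 1/2" "\<And>n. v (n + 1) * (c (- n - 1) + v n) = -1"
    using exists_riccati_solution[of "\<lambda>n. c (- n - 1)"] c by blast
  define p where "p n = v (- n)" for n
  have p: "\<bar>p n\<bar> \<le> 1/2" "p n * (c n + p (n + 1)) = -1" for n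
  proof -
    have "- (n + 1) = - n - 1" by simp
    then show "p n * (c n + p (n + 1)) = -1"
      unfolding p_def using v(2)[of "- n - 1"] by simp
    show "\<bar>p n\<bar> \<le> 1/2"
      unfolding p_def by (rule v(1))
  qed
  have p0: "p n \<noteq> 0" and u0: "c n + u n \<noteq> 0" for n
    using p(2)[of n] u(2)[of n] by auto
  have stable: "frechet_derivative (lozi (b n)) (at (z n)) (p n, 1) = (- p n) *\<^sub>R (p (n + 1), 1)" for n
    using p(2)[of n] by (simp add: D algebra_simps)
  have unstable: "frechet_derivative (lozi (b n)) (at (z n)) (1, u n) = (c n + u n) *\<^sub>R (1, u (n + 1))" for n
    using u(2)[of n] by (simp add: D algebra_simps)
  have backward: "frechet_derivative (inv (lozi (b (n - 1)))) (at (z n)) (1, u n) = (- u n) *\<^sub>R (1, u (n - 1))" for n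
    using u(2)[of "n - 1"] by (simp add: I' algebra_simps)
  define Es Eu where "Es n = span {(p n, 1 :: real)}" and "Eu n = span {(1 :: real, u n)}" for n
  \<comment> \<open>Up to sign this is the determinant of the two spanning vectors, so it expresses
    transversality of the lines.\<close>
  have pu: "1 - p n * u n \<noteq> 0" for n
  proof -
    have "\<bar>p n\<bar> * \<bar>u n\<bar> \<le> 1/2 * (1/2)"
      by (rule mult_mono) (use p(1) u(1) in auto)
    then show ?thesis by (auto simp flip: abs_mult)
  qed
  \<comment> \<open>The spanning vectors have norms between \<open>1\<close> and \<open>2\<close>,
    which is where the constant \<open>C = 2\<close> comes from.\<close>
  have decay: "norm (q *\<^sub>R w) \<le> 2 * (1/2) ^ k * norm (s *\<^sub>R w')"
    if "\<bar>q\<bar> \<le> (1/2) ^ k * \<bar>s\<bar>" "norm w \<le> 2" "1 \<le> norm w'" for q s k and w w' :: "real \<times> real"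
  proof -
    have "norm (q *\<^sub>R w) \<le> ((1/2) ^ k * \<bar>s\<bar>) * 2"
      unfolding norm_scaleR using that by (intro mult_mono) auto
    also have "\<dots> \<le> 2 * (1/2) ^ k * (\<bar>s\<bar> * norm w')"
      using that(3) by (simp add: mult_left_le[of "norm w'"] mult_le_cancel_left1 zero_le_mult_iff)
    finally show ?thesis by simp
  qed
  have norms: "norm (p n, 1 :: real) \<le> 2" "norm (1 :: real, u n) \<le> 2"
      "1 \<le> norm (p n, 1 :: real)" "1 \<le> norm (1 :: real, u n)" for n
    using norm_Pair_le[of "p n" "1 :: real"] norm_Pair_le[of "1 :: real" "u n"] p(1)[of n] u(1)[of n]
      norm_snd_le[where y = "1 :: real" and x = "p n"] norm_fst_le[where x = "1 :: real" and y = "u n"]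
    by auto
  have "\<forall>n. subspace (Es n) \<and> dim (Es n) = 1 \<and> subspace (Eu n) \<and> dim (Eu n) = 1 \<and>
      Es n \<inter> Eu n = {0} \<and> {u + v | u v. u \<in> Es n \<and> v \<in> Eu n} = UNIV \<and>
      frechet_derivative (lozi (b n)) (at (z n)) ` Es n = Es (n + 1) \<and>
      frechet_derivative (lozi (b n)) (at (z n)) ` Eu n = Eu (n + 1) \<and>
      (\<forall>v\<in>Es n. \<forall>k. norm (forward_cocycle (\<lambda>n. lozi (b n)) z n k v) \<le> 2 * (1/2) ^ k * norm v) \<and>
      (\<forall>v\<in>Eu n. \<forall>k. norm (backward_cocycle (\<lambda>n. lozi (b n)) z n k v) \<le> 2 * (1/2) ^ k * norm v)"
  proof (intro allI conjI ballI)
    fix n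
    show "subspace (Es n)" "subspace (Eu n)"
      by (simp_all add: Es_def Eu_def)
    show "dim (Es n) = 1" "dim (Eu n) = 1"
      by (simp_all add: Es_def Eu_def prod_eq_iff)
    have "w = 0" if wEs: "w \<in> Es n" and wEu: "w \<in> Eu n" for w
    proof -
      obtain s where s: "w = s *\<^sub>R (p n, 1)"
        using wEs by (auto simp: Es_def span_singleton)
      obtain t where t: "w = t *\<^sub>R (1, u n)"
        using wEu by (auto simp: Eu_def span_singleton)
      have tu: "s * p n = t" "s = t * u n"
        using s t by auto
      have "s * (1 - p n * u n) = s - (s * p n) * u n" by (simp add: algebra_simps)
      also have "\<dots> = 0" unfolding tu(1) using tu(2) by simp
      finally have "s * (1 - p n * u n) = 0" .
      then show ?thesis using pu[of n] s by (simp add: zero_prod_def)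
    qed
    then show "Es n \<inter> Eu n = {0}"
      by (auto simp: Es_def Eu_def span_0)
    have "\<exists>s t. (x, y) = s *\<^sub>R (p n, 1) + t *\<^sub>R (1, u n)" for x y
    proof (intro exI)
      define t where "t = (x - p n * y) / (1 - p n * u n)"
      have "t * (1 - p n * u n) = x - p n * y" using pu[of n] by (simp add: t_def)
      then show "(x, y) = (y - t * u n) *\<^sub>R (p n, 1) + t *\<^sub>R (1, u n)"
        by (simp add: algebra_simps)
    qed
    then show "{u + v | u v. u \<in> Es n \<and> v \<in> Eu n} = UNIV"
      by (fastforce simp: Es_def Eu_def span_singleton)
    have lin: "linear (frechet_derivative (lozi (b n)) (at (z n)))" for n
      using diff(1) by (rule linear_frechet_derivative)
    show "frechet_derivative (lozi (b n)) (at (z n)) ` Es n = Es (n + 1)"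
      unfolding Es_def by (rule linear_image_line[OF lin stable]) (use p0 in simp)
    show "frechet_derivative (lozi (b n)) (at (z n)) ` Eu n = Eu (n + 1)"
      unfolding Eu_def by (rule linear_image_line[OF lin unstable u0])
    fix w k
    show "norm (forward_cocycle (\<lambda>n. lozi (b n)) z n k w) \<le> 2 * (1/2) ^ k * norm w" if w: "w \<in> Es n"
    proof -
      obtain s where s: "w = s *\<^sub>R (p n, 1)"
        using w by (auto simp: Es_def span_singleton)
      obtain q where "forward_cocycle (\<lambda>n. lozi (b n)) z n k w = q *\<^sub>R (p (n + int k), 1)"
          "\<bar>q\<bar> \<le> (1/2) ^ k * \<bar>s\<bar>"
        using forward_cocycle_line[where w = "\<lambda>n. (p n, 1)", OF stable lin, of "1/2" n k s] p(1)
        unfolding s by auto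
      then show ?thesis using decay norms unfolding s by metis
    qed
    show "norm (backward_cocycle (\<lambda>n. lozi (b n)) z n k w) \<le> 2 * (1/2) ^ k * norm w" if w: "w \<in> Eu n"
    proof -
      obtain s where s: "w = s *\<^sub>R (1, u n)"
        using w by (auto simp: Eu_def span_singleton)
      obtain q where "backward_cocycle (\<lambda>n. lozi (b n)) z n k w = q *\<^sub>R (1, u (n - int k))"
          "\<bar>q\<bar> \<le> (1/2) ^ k * \<bar>s\<bar>"
        using backward_cocycle_line[where L = "\<lambda>n. lozi (b n)" and w = "\<lambda>n. (1, u n)",
            OF backward linear_frechet_derivative[OF diff'], of "1/2" n k s] u(1)
        unfolding s by auto
      then show ?thesis using decay norms unfolding s by metis
    qed
  qed
  note splitting = this
  show ?thesis
    unfolding saddle_type_def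
  proof (rule conjI)
    show "\<forall>n. lozi (b n) differentiable (at (z n)) \<and> inv (lozi (b n)) differentiable (at (z (n + 1)))"
      using diff by blast
  qed (rule exI[of _ Es], rule exI[of _ Eu], rule exI[of _ 2], rule exI[of _ "1/2"],
      intro conjI splitting; simp)
qed

subsection \<open>Symbolic dynamics\<close>

lemma uncountable_binary_sequences: "uncountable {s :: int \<Rightarrow> nat. \<forall>k. s k \<in> {1, 2}}"
proof
  assume "countable {s :: int \<Rightarrow> nat. \<forall>k. s k \<in> {1, 2}}"
  moreover have "(\<lambda>_. 1) \<in> {s :: int \<Rightarrow> nat. \<forall>k. s k \<in> {1, 2}}" by simp
  ultimately obtain f :: "nat \<Rightarrow> int \<Rightarrow> nat" where f: "range f = {s. \<forall>k. s k \<in> {1, 2}}"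
    using range_from_nat_into by (metis empty_iff)
  \<comment> \<open>Cantor's diagonal, with \<open>3 - t\<close> exchanging the symbols
    \<open>1\<close> and \<open>2\<close>. The contradiction arises at nonnegative positions;
    negative ones merely flip \<open>f 0\<close>.\<close>
  define s where "s k = 3 - f (nat k) k" for k
  have f12: "f m k = 1 \<or> f m k = 2" for m k
    using f by blast
  have "s k \<in> {1, 2}" for k
    using f12[of "nat k" k] by (auto simp: s_def)
  then obtain m where "s = f m"
    using f by blast
  then have "s (int m) = f m (int m)" by simp
  then show False
    using f12[of m "int m"] by (auto simp: s_def)
qed

lemma tendsto_coordinatewise:
  fixes f :: "'c \<Rightarrow> 'a \<Rightarrow> 'b :: topological_space"
  assumes "\<And>i. ((\<lambda>x. f x i) \<longlongrightarrow> l i) F"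
  shows "(f \<longlongrightarrow> l) F"
proof -
  have "limitin (product_topology (\<lambda>_. euclidean) UNIV) f l F"
    using assms by (simp add: limitin_componentwise)
  then show ?thesis
    by (simp add: euclidean_product_topology)
qed

context lozi_family
begin

text \<open>First coordinates of orbits: the second coordinate is eliminated by
  $y_{n+1} = - x_n$.\<close>

definition solutions :: "(int \<Rightarrow> real) set" where
  "solutions = {x. \<forall>n. \<bar>x n\<bar> \<le> R \<and> x (n + 1) + x (n - 1) + b n * \<bar>x n\<bar> = 1}"

definition point :: "int \<Rightarrow> (int \<Rightarrow> real) \<Rightarrow> real \<times> real" where
  "point n x = (x n, - x (n - 1))"

text \<open>Symbol \<open>1\<close> stands for \<open>x < 0\<close>, as for the strip with index
  \<open>1\<close>. On \<open>solutions\<close> the value \<open>0\<close> never occurs, so symbol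
  \<open>2\<close> means \<open>x > 0\<close> there.\<close>

definition itinerary :: "int \<Rightarrow> (int \<Rightarrow> real) \<Rightarrow> int \<Rightarrow> nat" where
  "itinerary n x = (\<lambda>k. if x (n + k) < 0 then 1 else 2)"

abbreviation "symbols \<equiv> {s :: int \<Rightarrow> nat. \<forall>k. s k \<in> {1, 2}}"

lemma symbol_space_eq: "symbol_space (transition H V) n = symbols"
proof -
  have "transition H V (n + k) (s k) (s (k + 1)) = 1" if "s \<in> symbols" for s k
    using that by (intro transition_eq_1) auto
  then show ?thesis unfolding symbol_space_def by blast
qed

section \<open>Bounded solutions of the scalar recurrence\<close>

lemma solutionsD:
  assumes "x \<in> solutions"
  shows "\<bar>x n\<bar> \<le> R" "x (n + 1) + x (n - 1) + b n * \<bar>x n\<bar> = 1"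
  using assms by (auto simp: solutions_def)

lemma solutions_gap_pos: "0 < (1 - 2 * R) / B"
  using R_half b_pos[of 0] b_le[of 0] by simp

text \<open>The recurrence gives \<open>b n * \<bar>x n\<bar> = 1 - x (n + 1) - x (n - 1) \<ge> 1 -
  2 * R\<close>. The gap makes the itinerary continuous and later serves as the sensitivity
  constant.\<close>

lemma solutions_gap:
  assumes "x \<in> solutions"
  shows "(1 - 2 * R) / B \<le> \<bar>x n\<bar>"
proof -
  have "1 - 2 * R \<le> b n * \<bar>x n\<bar>"
    using solutionsD(1)[OF assms, of "n + 1"] solutionsD(1)[OF assms, of "n - 1"]
      solutionsD(2)[OF assms, of n] by linarith
  also have "\<dots> \<le> B * \<bar>x n\<bar>"
    using b_le by (intro mult_right_mono) auto
  finally show ?thesis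
    using b_pos[of 0] b_le[of 0] by (simp add: divide_le_eq mult.commute)
qed

lemma solutions_nonzero: "x \<in> solutions \<Longrightarrow> x n \<noteq> 0"
  using solutions_gap[of x n] solutions_gap_pos by auto

lemma point_in_square: "x \<in> solutions \<Longrightarrow> point n x \<in> S"
  using solutionsD(1)[of x n] solutionsD(1)[of x "n - 1"]
  by (auto simp: point_def square_def abs_le_iff)

lemma lozi_point: "x \<in> solutions \<Longrightarrow> L n (point n x) = point (n + 1) x"
  using solutionsD(2)[of x n] by (simp add: point_def lozi_def)

lemma evolution_point: "x \<in> solutions \<Longrightarrow> evolution L n k (point n x) = point (n + int k) x"
  by (induction k) (simp_all add: lozi_point add.assoc add.commute[of 1])

text \<open>A point records two consecutive values, from which the recurrence determines all others
  in both time directions.\<close>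

lemma inj_on_point: "inj_on (point n) solutions"
proof (rule inj_onI)
  fix x y assume x: "x \<in> solutions" and y: "y \<in> solutions" and eq: "point n x = point n y"
  have "x k = y k \<and> x (k - 1) = y (k - 1)" for k
  proof (induction k rule: int_induct[where k = n])
    case base
    show ?case using eq by (simp add: point_def)
  next
    case (step1 k)
    then show ?case
      using solutionsD(2)[OF x, of k] solutionsD(2)[OF y, of k] by simp
  next
    case (step2 k)
    then show ?case
      using solutionsD(2)[OF x, of "k - 1"] solutionsD(2)[OF y, of "k - 1"] by simp
  qed
  then show "x = y" by auto
qed

text \<open>Prescribing the signs makes the recurrence affine, and solving it for \<open>x n\<close> yields a
  contraction because \<open>b n > 4\<close>.\<close>

lemma solution_unique_existence:
  fixes s :: "int \<Rightarrow> nat"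
  shows "\<exists>!x. x \<in> solutions \<and> (\<forall>n. x n < 0 \<longleftrightarrow> s n = 1)"
proof -
  define \<sigma> where "\<sigma> n = sym_sign (s n)" for n
  define T where "T x n = \<sigma> n * (1 - x (n + 1) - x (n - 1)) / b n" for x :: "int \<Rightarrow> real" and n
  have \<sigma>: "\<sigma> n * \<sigma> n = 1" "\<bar>\<sigma> n\<bar> = 1" for n
    by (simp_all add: \<sigma>_def)
  have "\<exists>!x. (\<forall>n. \<bar>x n\<bar> \<le> R) \<and> T x = x"
  proof (rule box_contraction_fixpoint[where c = "1/2"])
    fix x :: "int \<Rightarrow> real" and n assume x: "\<And>n. \<bar>x n\<bar> \<le> R"
    have "\<bar>T x n\<bar> = \<bar>1 - x (n + 1) - x (n - 1)\<bar> / b n"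
      using b_pos[of n] \<sigma> by (simp add: T_def abs_mult)
    also have "\<dots> \<le> R"
      using x[of "n + 1"] x[of "n - 1"] b_R[of n] b_pos[of n] by (simp add: divide_le_eq mult.commute)
    finally show "\<bar>T x n\<bar> \<le> R" .
  next
    fix x y :: "int \<Rightarrow> real" and d n assume d: "\<And>n. \<bar>x n - y n\<bar> \<le> d"
    have "T x n - T y n = \<sigma> n * ((y (n + 1) - x (n + 1)) + (y (n - 1) - x (n - 1))) / b n"
      by (simp add: T_def algebra_simps flip: diff_divide_distrib)
    then have "\<bar>T x n - T y n\<bar> = \<bar>(y (n + 1) - x (n + 1)) + (y (n - 1) - x (n - 1))\<bar> / b n"
      using b_pos[of n] \<sigma> by (simp add: abs_mult)
    also have "\<dots> \<le> (2 * d) / 4"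
      using d[of "n + 1"] d[of "n - 1"] b_gt[of n] by (intro frac_le) auto
    finally show "\<bar>T x n - T y n\<bar> \<le> 1/2 * d" by simp
  qed (use R_pos in auto)
  moreover have "(\<forall>n. \<bar>x n\<bar> \<le> R) \<and> T x = x \<longleftrightarrow> x \<in> solutions \<and> (\<forall>n. x n < 0 \<longleftrightarrow> s n = 1)"
    for x :: "int \<Rightarrow> real"
  proof
    assume x: "(\<forall>n. \<bar>x n\<bar> \<le> R) \<and> T x = x"
    \<comment> \<open>Positivity of this numerator is what forces a fixed point of the affine
      problem to carry the prescribed signs, and hence to solve the original recurrence.\<close>
    have pos: "0 < 1 - x (n + 1) - x (n - 1)" for n
    proof -
      have "\<bar>x (n + 1)\<bar> \<le> R" "\<bar>x (n - 1)\<bar> \<le> R"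
        using x by blast+
      then show ?thesis using R_half by linarith
    qed
    have "b n * (\<sigma> n * T x n) = (\<sigma> n * \<sigma> n) * (1 - x (n + 1) - x (n - 1))" for n
      using b_pos[of n] by (simp add: T_def)
    then have eq: "b n * (\<sigma> n * x n) = 1 - x (n + 1) - x (n - 1)" for n
      using x by (simp add: \<sigma>)
    then have sign: "0 < \<sigma> n * x n" for n
      using pos[of n] b_pos[of n] by (metis zero_less_mult_pos)
    have abs: "\<bar>x n\<bar> = \<sigma> n * x n" and neg: "x n < 0 \<longleftrightarrow> s n = 1" for n
      using sign[of n] by (cases "s n = 1"; simp add: \<sigma>_def sym_sign_def)+
    have "x (n + 1) + x (n - 1) + b n * \<bar>x n\<bar> = 1" for n
      unfolding abs eq by simp
    then show "x \<in> solutions \<and> (\<forall>n. x n < 0 \<longleftrightarrow> s n = 1)"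
      using conjunct1[OF x] neg unfolding solutions_def by blast
  next
    assume "x \<in> solutions \<and> (\<forall>n. x n < 0 \<longleftrightarrow> s n = 1)"
    then have x: "x \<in> solutions" and neg: "\<And>n. x n < 0 \<longleftrightarrow> s n = 1" by auto
    have "T x n = x n" for n
    proof -
      have abs: "\<bar>x n\<bar> = \<sigma> n * x n"
        using neg[of n] by (auto simp: \<sigma>_def sym_sign_def)
      have "1 - x (n + 1) - x (n - 1) = b n * \<bar>x n\<bar>"
        using solutionsD(2)[OF x, of n] by linarith
      then have "T x n = (\<sigma> n * \<sigma> n) * x n"
        using b_pos[of n] by (simp add: T_def abs)
      then show ?thesis by (simp add: \<sigma>)
    qed
    then show "(\<forall>n. \<bar>x n\<bar> \<le> R) \<and> T x = x"
      using solutionsD(1)[OF x] by blast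
  qed
  ultimately show ?thesis by simp
qed

section \<open>The sign coding as a homeomorphism\<close>

lemma bij_betw_itinerary: "bij_betw (itinerary n) solutions symbols"
proof (rule bij_betwI')
  fix x y assume x: "x \<in> solutions" and y: "y \<in> solutions"
  show "itinerary n x = itinerary n y \<longleftrightarrow> x = y"
  proof
    assume eq: "itinerary n x = itinerary n y"
    have "x k < 0 \<longleftrightarrow> y k < 0" for k
      using fun_cong[OF eq, of "k - n"] by (auto simp: itinerary_def split: if_splits)
    then show "x = y"
      using solution_unique_existence[of "itinerary 0 x"] x y by (auto simp: itinerary_def)
  qed simp
next
  fix x show "itinerary n x \<in> symbols"
    by (simp add: itinerary_def)
next
  fix s :: "int \<Rightarrow> nat" assume s: "s \<in> symbols"
  obtain x where x: "x \<in> solutions" "\<And>m. x m < 0 \<longleftrightarrow> s (m - n) = 1"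
    using solution_unique_existence[of "\<lambda>m. s (m - n)"] by blast
  have "s = itinerary n x"
    using x(2) s by (auto simp: itinerary_def fun_eq_iff)
  then show "\<exists>x\<in>solutions. s = itinerary n x"
    using x(1) by blast
qed

text \<open>Tychonoff's theorem for the box, cut by equations that are closed because each involves
  only three coordinates.\<close>

lemma compact_solutions: "compact solutions"
proof -
  have "compactin (product_topology (\<lambda>_. euclidean) UNIV) (Pi\<^sub>E (UNIV :: int set) (\<lambda>_. {-R..R}))"
    by (simp add: compactin_PiE compactin_euclidean_iff)
  then have "compact (Pi\<^sub>E (UNIV :: int set) (\<lambda>_. {-R..R}))"
    by (simp add: euclidean_product_topology compactin_euclidean_iff)
  moreover have "closed {x :: int \<Rightarrow> real. \<forall>n. x (n + 1) + x (n - 1) + b n * \<bar>x n\<bar> = 1}"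
    by (intro closed_Collect_all closed_Collect_eq continuous_intros continuous_on_product_coordinates)
  ultimately have "compact (Pi\<^sub>E (UNIV :: int set) (\<lambda>_. {-R..R}) \<inter>
      {x. \<forall>n. x (n + 1) + x (n - 1) + b n * \<bar>x n\<bar> = 1})"
    by (rule compact_Int_closed)
  also have "Pi\<^sub>E (UNIV :: int set) (\<lambda>_. {-R..R}) \<inter>
      {x. \<forall>n. x (n + 1) + x (n - 1) + b n * \<bar>x n\<bar> = 1} = solutions"
    by (auto simp: solutions_def PiE_iff abs_le_iff minus_le_iff)
  finally show ?thesis .
qed

text \<open>A continuous injection of a compact space into a Hausdorff space; it identifies the
  planar topology of the invariant set with the product topology on whole orbits.\<close>

lemma homeomorphism_point: "\<exists>g. homeomorphism solutions (point n ` solutions) (point n) g"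
proof (rule homeomorphism_compact[OF compact_solutions _ refl inj_on_point])
  show "continuous_on solutions (point n)"
    unfolding point_def
    by (intro continuous_intros continuous_on_subset[OF continuous_on_product_coordinates] subset_UNIV)
qed

text \<open>The codomain is passed through real-valued sequences because the library provides the
  Hausdorff property of a function space only for metric codomains.\<close>

lemma homeomorphism_itinerary: "\<exists>g. homeomorphism solutions symbols (itinerary n) g"
proof -
  define e where "e s = (\<lambda>k. real (s k))" for s :: "int \<Rightarrow> nat"
  have cont_e: "continuous_on A e" for A
    unfolding e_def
    by (intro continuous_on_coordinatewise_then_product continuous_on_of_nat
        continuous_on_subset[OF continuous_on_product_coordinates] subset_UNIV)
  have cont: "continuous_on solutions (itinerary n)"
    unfolding itinerary_def
  proof (rule continuous_on_coordinatewise_then_product)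
    fix k
    \<comment> \<open>The symbol jumps only at \<open>0\<close>, a value that no solution
      takes.\<close>
    have "continuous_on ({..<0} \<union> {0<..}) (\<lambda>t :: real. if t < 0 then 1 else 2 :: nat)"
    proof (rule continuous_on_open_Un)
      show "continuous_on {..<0} (\<lambda>t :: real. if t < 0 then 1 else 2 :: nat)"
        by (rule continuous_on_eq[OF continuous_on_const[of _ 1]]) auto
      show "continuous_on {0<..} (\<lambda>t :: real. if t < 0 then 1 else 2 :: nat)"
        by (rule continuous_on_eq[OF continuous_on_const[of _ 2]]) auto
    qed auto
    from this continuous_on_subset[OF continuous_on_product_coordinates subset_UNIV]
    show "continuous_on solutions (\<lambda>x. if x (n + k) < 0 then 1 else 2 :: nat)"
    proof (rule continuous_on_compose2)
      show "(\<lambda>x. x (n + k)) ` solutions \<subseteq> {..<0} \<union> {0<..}"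
        using solutions_nonzero[of _ "n + k"] by (auto simp: not_less order_less_le)
    qed
  qed
  note bij = bij_betw_itinerary[of n]
  have inj: "inj_on (e \<circ> itinerary n) solutions"
    using bij by (intro comp_inj_on bij_betw_imp_inj_on inj_onI) (auto simp: e_def fun_eq_iff)
  have "(e \<circ> itinerary n) ` solutions = e ` symbols"
    unfolding image_comp[symmetric] bij_betw_imp_surj_on[OF bij] ..
  then obtain g where g: "homeomorphism solutions (e ` symbols) (e \<circ> itinerary n) g"
    using homeomorphism_compact[OF compact_solutions continuous_on_compose[OF cont cont_e] _ inj]
    by blast
  have "homeomorphism solutions symbols (itinerary n) (g \<circ> e)"
  proof (rule homeomorphismI)
    show "continuous_on symbols (g \<circ> e)"
      using g cont_e by (intro continuous_on_compose) (auto simp: homeomorphism_def)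
    show "(g \<circ> e) (itinerary n x) = x" if "x \<in> solutions" for x
      using homeomorphism_apply1[OF g that] by simp
    then show "itinerary n ((g \<circ> e) s) = s" if "s \<in> symbols" for s
      using that bij_betw_imp_surj_on[OF bij] by (metis imageE)
    show "(g \<circ> e) ` symbols \<subseteq> solutions"
      using homeomorphism_image2[OF g] by (simp only: image_comp[symmetric])
  qed (use cont bij_betw_imp_surj_on[OF bij] in auto)
  then show ?thesis by blast
qed

section \<open>Uncountably many orbits, saddle type and sensitivity\<close>

lemma uncountable_orbits: "uncountable (orbits L (\<lambda>n. point n ` solutions))"
proof
  assume "countable (orbits L (\<lambda>n. point n ` solutions))"
  then have "countable ((\<lambda>z. itinerary 0 (\<lambda>m. fst (z m))) ` orbits L (\<lambda>n. point n ` solutions))"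
    by (rule countable_image)
  moreover have "symbols \<subseteq> (\<lambda>z. itinerary 0 (\<lambda>m. fst (z m))) ` orbits L (\<lambda>n. point n ` solutions)"
  proof
    fix s assume "s \<in> symbols"
    then obtain x where x: "x \<in> solutions" "s = itinerary 0 x"
      using bij_betw_imp_surj_on[OF bij_betw_itinerary] by blast
    have "(\<lambda>m. point m x) \<in> orbits L (\<lambda>n. point n ` solutions)"
      using x(1) by (simp add: orbits_def lozi_point)
    moreover have "s = itinerary 0 (\<lambda>m. fst (point m x))"
      by (simp add: x(2) point_def)
    ultimately show "s \<in> (\<lambda>z. itinerary 0 (\<lambda>m. fst (z m))) ` orbits L (\<lambda>n. point n ` solutions)"
      by (intro image_eqI[where x = "\<lambda>m. point m x"])
  qed
  ultimately show False
    using uncountable_binary_sequences countable_subset by blast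
qed

lemma saddle_type_orbit:
  assumes "z \<in> orbits L (\<lambda>n. point n ` solutions)"
  shows "saddle_type L z"
proof (rule saddle_type_lozi)
  show "4 \<le> \<bar>b n\<bar>" for n
    using b_gt[of n] by simp
  show "fst (z n) \<noteq> 0" "z (n + 1) = lozi (b n) (z n)" for n
    using assms solutions_nonzero by (auto simp: orbits_def point_def dest!: spec[of _ n])
qed

text \<open>Flipping the symbol at position \<open>N\<close> moves the point arbitrarily little for
  large \<open>N\<close>, by continuity of the inverse coding. After \<open>N\<close> steps the two
  first coordinates have different signs, so they differ by at least the gap.\<close>

lemma sensitive: "sensitive_dependence L (\<lambda>n. point n ` solutions)"
  unfolding sensitive_dependence_def
proof (intro exI[of _ "(1 - 2 * R) / B"] conjI solutions_gap_pos allI ballI impI)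
  fix n z U assume "z \<in> point n ` solutions" and U: "open U \<and> z \<in> U"
  then obtain x where x: "x \<in> solutions" "z = point n x" by blast
  obtain g where g: "homeomorphism solutions symbols (itinerary n) g"
    using homeomorphism_itinerary by blast
  obtain h where h: "homeomorphism solutions (point n ` solutions) (point n) h"
    using homeomorphism_point by blast
  define s where "s N k = (if k = int N then 3 - itinerary n x k else itinerary n x k)" for N k
  have s_mem: "s N \<in> symbols" for N
    by (auto simp: s_def itinerary_def)
  have s_lim: "s \<longlonglongrightarrow> itinerary n x"
  proof (rule tendsto_coordinatewise, rule tendsto_eventually)
    show "\<forall>\<^sub>F N in sequentially. s N k = itinerary n x k" for k
      using eventually_gt_at_top[of "nat k"] by eventually_elim (auto simp: s_def)
  qed
  have "continuous_on symbols (point n \<circ> g)"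
    using g h by (intro continuous_on_compose) (auto simp: homeomorphism_def)
  then have "(\<lambda>N. (point n \<circ> g) (s N)) \<longlonglongrightarrow> (point n \<circ> g) (itinerary n x)"
    by (rule continuous_on_tendsto_compose[OF _ s_lim]) (use s_mem in \<open>auto simp: itinerary_def\<close>)
  also have "(point n \<circ> g) (itinerary n x) = z"
    using homeomorphism_apply1[OF g x(1)] x(2) by simp
  finally have "\<forall>\<^sub>F N in sequentially. (point n \<circ> g) (s N) \<in> U"
    using U topological_tendstoD by blast
  \<comment> \<open>The flip position is also the separation time, which has to be at least
    \<open>1\<close>.\<close>
  then have "\<forall>\<^sub>F N in sequentially. (point n \<circ> g) (s N) \<in> U \<and> 1 \<le> N"
    using eventually_ge_at_top by (rule eventually_conj)
  then obtain N where N: "point n (g (s N)) \<in> U" "1 \<le> N"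
    using eventually_happens trivial_limit_sequentially by fastforce
  define y where "y = g (s N)"
  have y: "y \<in> solutions" "itinerary n y = s N"
    using g s_mem[of N] homeomorphism_apply2[OF g] homeomorphism_image2[OF g] by (auto simp: y_def)
  have "itinerary n y (int N) = 3 - itinerary n x (int N)"
    unfolding y(2) by (simp add: s_def)
  then have "x (n + int N) < 0 \<longleftrightarrow> \<not> y (n + int N) < 0"
    by (auto simp: itinerary_def split: if_splits)
  then have "(1 - 2 * R) / B \<le> \<bar>x (n + int N) - y (n + int N)\<bar>"
    using solutions_gap[OF x(1), of "n + int N"] by (auto simp: abs_if split: if_splits)
  also have "\<dots> \<le> dist (point (n + int N) x) (point (n + int N) y)"
    using dist_fst_le[of "point (n + int N) x" "point (n + int N) y"]
    by (simp add: point_def dist_real_def)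
  finally show "\<exists>z'\<in>U \<inter> point n ` solutions. \<exists>k\<ge>1.
      (1 - 2 * R) / B \<le> dist (evolution L n k z) (evolution L n k z')"
    using N y(1) by (intro bexI[of _ "point n y"] exI[of _ N])
      (auto simp: x evolution_point y_def)
qed

text \<open>The invariant sets are the evaluations of all solutions at time \<open>n\<close>, and
  the coding recovers the solution and reads its signs from time \<open>n\<close> on in both
  directions. Conjugacy with the shift holds because a point and its image come from the same
  solution, read from an origin one step later.\<close>

lemma chaotic_saddle:
  "\<exists>\<Lambda> \<phi>. (\<forall>n. \<Lambda> n \<subseteq> S) \<and> (\<forall>n. L n ` \<Lambda> n = \<Lambda> (n + 1)) \<and>
     (\<forall>n. \<exists>\<psi>. homeomorphism (\<Lambda> n) (symbol_space (transition H V) n) (\<phi> n) \<psi>) \<and>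
     (\<forall>n. \<forall>z\<in>\<Lambda> n. \<phi> (n + 1) (L n z) = shift (\<phi> n z)) \<and>
     uncountable (orbits L \<Lambda>) \<and> (\<forall>z\<in>orbits L \<Lambda>. saddle_type L z) \<and> sensitive_dependence L \<Lambda>"
proof -
  obtain h where h: "\<And>n. homeomorphism solutions (point n ` solutions) (point n) (h n)"
    using homeomorphism_point by metis
  obtain g where g: "\<And>n. homeomorphism solutions symbols (itinerary n) (g n)"
    using homeomorphism_itinerary by metis
  have h_point: "h n (point n x) = x" if "x \<in> solutions" for n x
    using homeomorphism_apply1[OF h that] .
  show ?thesis
  proof (intro exI[of _ "\<lambda>n. point n ` solutions"] exI[of _ "\<lambda>n. itinerary n \<circ> h n"] conjI allI ballI)
    fix n
    show "point n ` solutions \<subseteq> S"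
      using point_in_square by blast
    show "L n ` point n ` solutions = point (n + 1) ` solutions"
      by (simp add: image_image lozi_point cong: image_cong)
    show "\<exists>\<psi>. homeomorphism (point n ` solutions) (symbol_space (transition H V) n) (itinerary n \<circ> h n) \<psi>"
      unfolding symbol_space_eq
      using homeomorphism_compose[OF homeomorphism_symD[OF h] g] by blast
    fix z assume "z \<in> point n ` solutions"
    then obtain x where x: "x \<in> solutions" "z = point n x" by blast
    show "(itinerary (n + 1) \<circ> h (n + 1)) (L n z) = shift ((itinerary n \<circ> h n) z)"
      by (simp add: x lozi_point h_point shift_def itinerary_def fun_eq_iff ac_simps)
  qed (fact uncountable_orbits saddle_type_orbit sensitive)+
qed

end

section \<open>Application to the given coefficients\<close>

theorem theorem5:
  fixes a :: real
  assumes "a > 4"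
  shows "\<exists>\<epsilon>0>0. \<forall>\<epsilon>. 0 \<le> \<epsilon> \<and> \<epsilon> < \<epsilon>0 \<longrightarrow>
    (let L = lozi_seq a \<epsilon>;
         R = a / (4 * (a - 2));
         S = square R;
         H = horiz_set L S;
         V = vert_set L S;
         A = transition H V
     in
       (\<exists>\<mu>h \<mu>v \<mu>. 0 \<le> \<mu>h \<and> 0 \<le> \<mu>v \<and> 0 < \<mu> \<and> \<mu> < 1 - \<mu>h * \<mu>v \<and>
          (\<forall>n. \<forall>i\<in>{1, 2}. vertical_strip R \<mu>v {-R..R} (V n i) \<and>
                            horizontal_strip R \<mu>h {-R..R} (H (n + 1) i)) \<and>
          conley_moser_1 L R H V \<mu>h \<mu>v \<and>
          conley_moser_3 L V \<mu>h \<mu>v \<mu>) \<and>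
       (\<exists>\<Lambda> \<phi>.
          (\<forall>n. \<Lambda> n \<subseteq> S) \<and>
          (\<forall>n. L n ` \<Lambda> n = \<Lambda> (n + 1)) \<and>
          (\<forall>n. \<exists>\<psi>. homeomorphism (\<Lambda> n) (symbol_space A n) (\<phi> n) \<psi>) \<and>
          (\<forall>n. \<forall>z\<in>\<Lambda> n. \<phi> (n + 1) (L n z) = shift (\<phi> n z)) \<and>
          uncountable (orbits L \<Lambda>) \<and>
          (\<forall>z\<in>orbits L \<Lambda>. saddle_type L z) \<and>
          sensitive_dependence L \<Lambda>))"
\<comment> \<open>The value \<open>1\<close> for the bound on \<open>\<epsilon>\<close> enters only
  through the uniform upper bound \<open>a + 2\<close> of the coefficients.\<close>
proof (intro exI[of _ 1] conjI allI impI, goal_cases)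
  case 1
  show ?case by simp
next
  case \<epsilon>: (2 \<epsilon>)
  define b where "b n = a + \<epsilon> * (1 + cos (real_of_int n))" for n
  define R where "R = a / (4 * (a - 2))"
  have L: "lozi_seq a \<epsilon> = (\<lambda>n. lozi (b n))"
    by (simp add: fun_eq_iff lozi_seq_def b_def)
  interpret lozi_family b R "a + 2"
  proof
    show R: "0 < R" "2 * R < 1"
      using assms by (simp_all add: R_def field_simps)
    \<comment> \<open>Hence \<open>R * (a - 2) > 1\<close>, which is
      \<open>1 + 2 * R < a * R\<close>. For this \<open>R\<close>, the condition
      \<open>2 * R < 1\<close> likewise amounts to \<open>a > 4\<close>.\<close>
    have "R * (a - 2) = a / 4"
      using assms by (simp add: R_def field_simps)
    then have "1 + 2 * R < a * R"
      using assms by (simp add: algebra_simps)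
    moreover have "a \<le> b n" "b n \<le> a + 2" for n
    proof -
      have "0 \<le> 1 + cos (real_of_int n)" "1 + cos (real_of_int n) \<le> 2"
        using cos_ge_minus_one[of "real_of_int n"] cos_le_one[of "real_of_int n"] by linarith+
      then have "0 \<le> \<epsilon> * (1 + cos (real_of_int n))" "\<epsilon> * (1 + cos (real_of_int n)) \<le> 1 * 2"
        using \<epsilon> by (intro mult_nonneg_nonneg mult_mono; simp)+
      then show "a \<le> b n" "b n \<le> a + 2"
        by (simp_all add: b_def)
    qed
    ultimately show "1 + 2 * R < b n * R" "b n \<le> a + 2" for n
      using R(1) by (meson less_le_trans mult_right_mono less_imp_le)+
  qed
  show ?case
    unfolding Let_def L R_def[symmetric]
  proof (rule conjI)
    show "\<exists>\<mu>h \<mu>v \<mu>. 0 \<le> \<mu>h \<and> 0 \<le> \<mu>v \<and> 0 < \<mu> \<and> \<mu> < 1 - \<mu>h * \<mu>v \<and>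
          (\<forall>n. \<forall>i\<in>{1, 2}. vertical_strip R \<mu>v {-R..R} (V n i) \<and>
                            horizontal_strip R \<mu>h {-R..R} (H (n + 1) i)) \<and>
          conley_moser_1 L R H V \<mu>h \<mu>v \<and> conley_moser_3 L V \<mu>h \<mu>v \<mu>"
      using strips conley_moser_1 conley_moser_3
      by (intro exI[of _ "1/2 :: real"] conjI ballI allI) simp_all
  qed (rule chaotic_saddle)
qed

end
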